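(* Let $V\colon\mathbb{R}\to[0,\infty)$ be Borel measurable and let $(\nu_n)_{n\in\mathbb{N}}$ be the sequence of finite-volume mean-field Gibbs measures with potential $V$ (and reference measures $\mu_{\mathcal{N}(0,I_n)}$). (a) For $n\in\mathbb{N}$ define $\overline\gamma_n\colon\mathbb{R}\times\mathcal{B}(\mathbb{R})\to[0,1]$ by $$\overline\gamma_n(\alpha,A)=\frac{\int_{\mathbb{R}}\mathbf{1}_A(x)\,e^{-nV\left(\frac{n-1}{n}\alpha+\frac{x}{n}\right)}e^{-x^2/2}\,dx}{\int_{\mathbb{R}}e^{-nV\left(\frac{n-1}{n}\alpha+\frac{x}{n}\right)}e^{-x^2/2}\,dx}\qquad(\alpha\in\mathbb{R},\ A\in\mathcal{B}(\mathbb{R})).$$ Then for every $n\ge 2$ the map $\gamma_n\colon\mathbb{R}^{n-1}\times\mathcal{B}(\mathbb{R})\to[0,1]$, $\gamma_n(v,A)=\overline\gamma_n(m_{n-1}(v),A)$, is the weakly continuous proper regular conditional probability under $\nu_n$ of the first spin given the other spins. (b) If $V$ is continuously differentiable on a neighbourhood of $\alpha\in\mathbb{R}$, then for every sequence $(\alpha_n)_{n\in\mathbb{N}}$ in $\mathbb{R}$ converging to $\alpha$ the measures $\overline\gamma_n(\alpha_n,\cdot)$ converge weakly, and even strongly (i.e. $\overline\gamma_n(\alpha_n,A)\to\mu_{\mathcal{N}(-V'(\alpha),1)}(A)$ for every $A\in\mathcal{B}(\mathbb{R})$), to $\mu_{\mathcal{N}(-V'(\alpha),1)}$. In particular, $\alpha$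 is a good magnetisation for $(\nu_n)_{n\in\mathbb{N}}$. (c) If $V$ is continuously differentiable on $\mathbb{R}$, then $(\nu_n)_{n\in\mathbb{N}}$ is sequentially Gibbs.
   Context: $\mathcal{B}(\cdot)$ denotes the Borel $\sigma$-algebra. $\mu_{\mathcal{N}(v,A)}$ is the normal distribution with mean $v$ and covariance $A$; $I_n$ is the $n\times n$ identity matrix. The empirical magnetisation is $m_n\colon\mathbb{R}^n\to\mathbb{R}$, $m_n(x_1,\dots,x_n)=\frac1n\sum_{i=1}^n x_i$. The sequence of finite-volume mean-field Gibbs measures with (Borel measurable) potential $V\colon\mathbb{R}\to[0,\infty)$ is the sequence of probability measures on $\mathcal{B}(\mathbb{R}^n)$ given by $\nu_n(A)=\frac1{Z_n}\int_{\mathbb{R}^n}\mathbf{1}_A(x)\,e^{-nV(m_n(x))}\,d\mu_{\mathcal{N}(0,I_n)}(x)$, where $Z_n\in(0,\infty)$ is the normalising constant. For a probability measure $\rho_n$ on $\mathcal{B}(\mathbb{R}^n)$, $n\ge2$, let $\pi_{(2:n)}(y_1,\dots,y_n)=(y_2,\dots,y_n)$. A regular conditional probability under $\rho_n$ of the first spin given the other spins is a transition kernel $\gamma_n\colon\mathbb{R}^{n-1}\times\mathcal{B}(\mathbb{R})\to[0,1]$ with $\rho_n(A\times B)=\int \mathbf{1}_B(y)\,\gamma_n(y,A)\,d[\rho_n\circ\pi_{(2:n)}^{-1}](y)$ for all $A\in\mathcal{B}(\mathbb{R})$, $B\in\mathcal{B}(\mathbb{R}^{n-1})$. It is proper if $\gamma_n(y,\cdot)=0$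 for all $y$ outside the support of $\rho_n\circ\pi_{(2:n)}^{-1}$, and weakly continuous if $y\mapsto\gamma_n(y,\cdot)$ is continuous for the weak topology. A weakly continuous proper regular conditional probability is unique if it exists. Let $(\rho_n)_{n\in\mathbb{N}}$ be probability measures on $\mathcal{B}(\mathbb{R}^n)$ such that for every $n\ge 2$ a weakly continuous proper regular conditional probability $\gamma_n$ of the first spin given the other spins exists. Then $\alpha\in\mathbb{R}$ is a good magnetisation for $(\rho_n)$ if there is a probability measure $\gamma_\alpha$ on $\mathcal{B}(\mathbb{R})$ such that $\gamma_n(v_{n-1},\cdot)\to\gamma_\alpha$ weakly for all sequences $(v_{n-1})_{n\ge2}$ with $v_{n-1}\in\mathbb{R}^{n-1}$ and $m_{n-1}(v_{n-1})\to\alpha$. The sequence $(\rho_n)$ is sequentially Gibbs if all $\alpha\in\mathbb{R}$ are good magnetisations. *)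

theory Defs
  imports "HOL-Probability.Probability"
begin

text \<open>
  The dimension varies inside the definitions, so \<open>\<real>\<^sup>n\<close> is rendered as the set of extensional functions
  on \<open>{..<n}\<close>, with the product sigma-algebra and the product topology. Spins are numbered from \<open>0\<close>.
\<close>

abbreviation euclid :: "nat \<Rightarrow> (nat \<Rightarrow> real) measure" where
  "euclid n \<equiv> PiM {..<n} (\<lambda>_. borel)"

abbreviation euclid_top :: "nat \<Rightarrow> (nat \<Rightarrow> real) topology" where
  "euclid_top n \<equiv> product_topology (\<lambda>_. euclideanreal) {..<n}"

definition mag :: "nat \<Rightarrow> (nat \<Rightarrow> real) \<Rightarrow> real" where
  "mag n x = (\<Sum>i<n. x i) / real n"

text \<open>The centred normal distribution with identity covariance.\<close>

definition std_gaussian :: "nat \<Rightarrow> (nat \<Rightarrow> real) measure" where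
  "std_gaussian n = density (PiM {..<n} (\<lambda>_. lborel))
     (\<lambda>x. ennreal (exp (- (\<Sum>i<n. (x i)\<^sup>2) / 2) / sqrt (2 * pi) ^ n))"

definition gibbs_Z :: "(real \<Rightarrow> real) \<Rightarrow> nat \<Rightarrow> real" where
  "gibbs_Z V n = (\<integral>x. exp (- (real n * V (mag n x))) \<partial>std_gaussian n)"

definition gibbs :: "(real \<Rightarrow> real) \<Rightarrow> nat \<Rightarrow> (nat \<Rightarrow> real) measure" where
  "gibbs V n = density (std_gaussian n)
     (\<lambda>x. ennreal (exp (- (real n * V (mag n x))) / gibbs_Z V n))"

definition gamma_weight :: "(real \<Rightarrow> real) \<Rightarrow> nat \<Rightarrow> real \<Rightarrow> real \<Rightarrow> real" where
  "gamma_weight V n \<alpha> x =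
     exp (- (real n * V ((real n - 1) / real n * \<alpha> + x / real n))) * exp (- x\<^sup>2 / 2)"

definition gamma_bar :: "(real \<Rightarrow> real) \<Rightarrow> nat \<Rightarrow> real \<Rightarrow> real measure" where
  "gamma_bar V n \<alpha> = density lborel
     (\<lambda>x. ennreal (gamma_weight V n \<alpha> x / (\<integral>t. gamma_weight V n \<alpha> t \<partial>lborel)))"

definition bdd_cont :: "(real \<Rightarrow> real) set" where
  "bdd_cont = {f. continuous_on UNIV f \<and> bounded (range f)}"

definition weakly_converges :: "(nat \<Rightarrow> real measure) \<Rightarrow> real measure \<Rightarrow> bool" where
  "weakly_converges M N \<longleftrightarrow>
     (\<forall>f\<in>bdd_cont. (\<lambda>n. integral\<^sup>L (M n) f) \<longlonglongrightarrow> integral\<^sup>L N f)"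

text \<open>
  Continuity with respect to the weak topology, which is the initial topology of the maps
  \<open>M \<mapsto> \<integral>f dM\<close> for bounded continuous \<open>f\<close>.
\<close>

definition weakly_continuous :: "'a topology \<Rightarrow> ('a \<Rightarrow> real measure) \<Rightarrow> bool" where
  "weakly_continuous X \<gamma> \<longleftrightarrow>
     (\<forall>f\<in>bdd_cont. continuous_map X euclideanreal (\<lambda>y. integral\<^sup>L (\<gamma> y) f))"

definition measure_support :: "'a topology \<Rightarrow> 'a measure \<Rightarrow> 'a set" where
  "measure_support X M = {y \<in> topspace X. \<forall>U. openin X U \<and> y \<in> U \<longrightarrow> emeasure M U > 0}"

definition other_spins :: "nat \<Rightarrow> (nat \<Rightarrow> real) \<Rightarrow> nat \<Rightarrow> real" where
  "other_spins n x = (\<lambda>i\<in>{..<n - 1}. x (Suc i))"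

abbreviation other_law :: "nat \<Rightarrow> (nat \<Rightarrow> real) measure \<Rightarrow> (nat \<Rightarrow> real) measure" where
  "other_law n \<rho> \<equiv> distr \<rho> (euclid (n - 1)) (other_spins n)"

text \<open>
  Kernels are sub-probability kernels: properness sets \<open>\<gamma> y\<close> to the zero measure off the support.
\<close>

definition regular_cond_prob ::
  "nat \<Rightarrow> (nat \<Rightarrow> real) measure \<Rightarrow> ((nat \<Rightarrow> real) \<Rightarrow> real measure) \<Rightarrow> bool" where
  "regular_cond_prob n \<rho> \<gamma> \<longleftrightarrow>
     prob_space \<rho> \<and> sets \<rho> = sets (euclid n) \<and>
     \<gamma> \<in> euclid (n - 1) \<rightarrow>\<^sub>M subprob_algebra borel \<and>
     (\<forall>A\<in>sets borel. \<forall>B\<in>sets (euclid (n - 1)).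
        emeasure \<rho> {x \<in> space \<rho>. x 0 \<in> A \<and> other_spins n x \<in> B} =
        (\<integral>\<^sup>+y. indicator B y * emeasure (\<gamma> y) A \<partial>other_law n \<rho>))"

definition proper_kernel ::
  "nat \<Rightarrow> (nat \<Rightarrow> real) measure \<Rightarrow> ((nat \<Rightarrow> real) \<Rightarrow> real measure) \<Rightarrow> bool" where
  "proper_kernel n \<rho> \<gamma> \<longleftrightarrow>
     (\<forall>y\<in>space (euclid (n - 1)) - measure_support (euclid_top (n - 1)) (other_law n \<rho>).
        \<gamma> y = null_measure borel)"

definition wcp_cond_prob ::
  "nat \<Rightarrow> (nat \<Rightarrow> real) measure \<Rightarrow> ((nat \<Rightarrow> real) \<Rightarrow> real measure) \<Rightarrow> bool" where
  "wcp_cond_prob n \<rho> \<gamma> \<longleftrightarrow>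
     regular_cond_prob n \<rho> \<gamma> \<and> proper_kernel n \<rho> \<gamma> \<and> weakly_continuous (euclid_top (n - 1)) \<gamma>"

text \<open>
  The kernels \<open>\<gamma> n\<close> are determined by \<open>\<rho> n\<close> (see \<open>wcp_cond_prob_unique\<close> below), so the
  existential quantifier over \<open>\<gamma>\<close> only expresses that they exist. Below, \<open>v n\<close> is a vector of
  dimension \<open>n\<close>; the entry at \<open>n = 0\<close> does not affect the limits.
\<close>

definition good_magnetisation :: "(nat \<Rightarrow> (nat \<Rightarrow> real) measure) \<Rightarrow> real \<Rightarrow> bool" where
  "good_magnetisation \<rho> \<alpha> \<longleftrightarrow>
     (\<exists>\<gamma>. (\<forall>n\<ge>2. wcp_cond_prob n (\<rho> n) (\<gamma> n)) \<and>
       (\<exists>\<gamma>\<^sub>\<alpha>. real_distribution \<gamma>\<^sub>\<alpha> \<and>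
         (\<forall>v. (\<forall>n\<ge>1. v n \<in> space (euclid n)) \<and> (\<lambda>n. mag n (v n)) \<longlonglongrightarrow> \<alpha> \<longrightarrow>
           weakly_converges (\<lambda>n. \<gamma> (Suc n) (v n)) \<gamma>\<^sub>\<alpha>)))"

definition sequentially_gibbs :: "(nat \<Rightarrow> (nat \<Rightarrow> real) measure) \<Rightarrow> bool" where
  "sequentially_gibbs \<rho> \<longleftrightarrow> (\<forall>\<alpha>. good_magnetisation \<rho> \<alpha>)"


text \<open>Consistency of these definitions with the library and with the usual formulas.\<close>

lemma std_gaussian_eq_PiM:
  "std_gaussian n = PiM {..<n} (\<lambda>_. density lborel (\<lambda>x. ennreal (std_normal_density x)))"
proof -
  let ?N = "density lborel (\<lambda>x. ennreal (std_normal_density x))"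
  interpret N: prob_space ?N by (rule prob_space_normal_density) simp
  interpret P: product_sigma_finite "\<lambda>_::nat. ?N" ..
  interpret L: product_sigma_finite "\<lambda>_::nat. lborel :: real measure" ..
  show ?thesis
  proof (rule P.PiM_eqI)
    show "finite {..<n}" by simp
    show "sets (std_gaussian n) = sets (PiM {..<n} (\<lambda>_. ?N))"
      unfolding std_gaussian_def sets_density by (rule sets_PiM_cong) auto
    fix A :: "nat \<Rightarrow> real set" assume "\<And>i. i \<in> {..<n} \<Longrightarrow> A i \<in> sets ?N"
    then have A: "\<And>i. i \<in> {..<n} \<Longrightarrow> A i \<in> sets borel" by simp
    have dens: "ennreal (exp (- (\<Sum>i<n. (x i)\<^sup>2) / 2) / sqrt (2 * pi) ^ n)
        = (\<Prod>i<n. ennreal (std_normal_density (x i)))" for x :: "nat \<Rightarrow> real"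
    proof -
      have "(\<Prod>i<n. std_normal_density (x i)) = exp (- (\<Sum>i<n. (x i)\<^sup>2) / 2) / sqrt (2 * pi) ^ n"
        by (simp add: std_normal_density_def prod_dividef exp_sum[symmetric] sum_negf
            sum_divide_distrib prod.distrib power_divide)
      then show ?thesis by (simp add: prod_ennreal)
    qed
    have E: "Pi\<^sub>E {..<n} A \<in> sets (PiM {..<n} (\<lambda>_. lborel :: real measure))"
      using A by (intro sets_PiM_I_finite) auto
    have "emeasure (std_gaussian n) (Pi\<^sub>E {..<n} A) =
        (\<integral>\<^sup>+x. ennreal (exp (- (\<Sum>i<n. (x i)\<^sup>2) / 2) / sqrt (2 * pi) ^ n) * indicator (Pi\<^sub>E {..<n} A) x
          \<partial>PiM {..<n} (\<lambda>_. lborel))"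
      unfolding std_gaussian_def by (rule emeasure_density[OF _ E]) measurable
    also have "\<dots> = (\<integral>\<^sup>+x. (\<Prod>i<n. ennreal (std_normal_density (x i)) * indicator (A i) (x i))
          \<partial>PiM {..<n} (\<lambda>_. lborel))"
    proof (rule nn_integral_cong)
      fix x assume x: "x \<in> space (PiM {..<n} (\<lambda>_. lborel :: real measure))"
      have "indicator (Pi\<^sub>E {..<n} A) x = (\<Prod>i<n. indicator (A i) (x i) :: ennreal)"
        using x by (cases "x \<in> Pi\<^sub>E {..<n} A")
          (auto simp: space_PiM PiE_iff prod_zero_iff split: split_indicator)
      then show "ennreal (exp (- (\<Sum>i<n. (x i)\<^sup>2) / 2) / sqrt (2 * pi) ^ n) * indicator (Pi\<^sub>E {..<n} A) x
          = (\<Prod>i<n. ennreal (std_normal_density (x i)) * indicator (A i) (x i))"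
        unfolding dens prod.distrib by simp
    qed
    also have "\<dots> = (\<Prod>i<n. \<integral>\<^sup>+x. ennreal (std_normal_density x) * indicator (A i) x \<partial>lborel)"
      using A by (intro L.product_nn_integral_prod) auto
    also have "\<dots> = (\<Prod>i<n. emeasure ?N (A i))"
      using A by (intro prod.cong refl) (auto simp: emeasure_density)
    finally show "emeasure (std_gaussian n) (Pi\<^sub>E {..<n} A) = (\<Prod>i<n. emeasure ?N (A i))" .
  qed
qed

lemma measure_gibbs:
  assumes V[measurable]: "V \<in> borel_measurable borel" and A: "A \<in> sets (euclid n)"
  shows "measure (gibbs V n) A =
    (\<integral>x. indicator A x * exp (- (real n * V (mag n x))) \<partial>std_gaussian n) / gibbs_Z V n"
proof -
  have sets_eq: "sets (std_gaussian n) = sets (euclid n)"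
    unfolding std_gaussian_def sets_density by (rule sets_PiM_cong) auto
  have [measurable]: "mag n \<in> borel_measurable (euclid n)"
    unfolding mag_def[abs_def] by measurable
  have "(\<lambda>x. exp (- (real n * V (mag n x)))) \<in> borel_measurable (euclid n)"
    by measurable
  then have w[measurable]: "(\<lambda>x. exp (- (real n * V (mag n x)))) \<in> borel_measurable (std_gaussian n)"
    by (simp cong: measurable_cong_sets add: sets_eq)
  have [measurable]: "A \<in> sets (std_gaussian n)" using A sets_eq by simp
  have Z0: "0 \<le> gibbs_Z V n" by (simp add: gibbs_Z_def)
  have "measure (gibbs V n) A = enn2real
      (\<integral>\<^sup>+x. ennreal (indicator A x * exp (- (real n * V (mag n x))) / gibbs_Z V n) \<partial>std_gaussian n)"
    unfolding gibbs_def measure_def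
    by (subst emeasure_density)
      (auto intro!: arg_cong[where f=enn2real] nn_integral_cong split: split_indicator)
  also have "\<dots> = (\<integral>x. indicator A x * exp (- (real n * V (mag n x))) / gibbs_Z V n \<partial>std_gaussian n)"
    using Z0 by (subst integral_eq_nn_integral) auto
  finally show ?thesis by simp
qed

lemma measure_gamma_bar:
  assumes [measurable]: "V \<in> borel_measurable borel" "A \<in> sets borel"
  shows "measure (gamma_bar V n \<alpha>) A =
    (\<integral>x. indicator A x * gamma_weight V n \<alpha> x \<partial>lborel) / (\<integral>x. gamma_weight V n \<alpha> x \<partial>lborel)"
proof -
  let ?Z = "\<integral>x. gamma_weight V n \<alpha> x \<partial>lborel"
  have w[measurable]: "gamma_weight V n \<alpha> \<in> borel_measurable borel"
    unfolding gamma_weight_def[abs_def] by measurable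
  have w0: "0 \<le> gamma_weight V n \<alpha> x" for x by (simp add: gamma_weight_def)
  then have Z0: "0 \<le> ?Z" by simp
  have "measure (gamma_bar V n \<alpha>) A =
      enn2real (\<integral>\<^sup>+x. ennreal (indicator A x * gamma_weight V n \<alpha> x / ?Z) \<partial>lborel)"
    unfolding gamma_bar_def measure_def
    by (subst emeasure_density)
      (auto intro!: arg_cong[where f=enn2real] nn_integral_cong split: split_indicator)
  also have "\<dots> = (\<integral>x. indicator A x * gamma_weight V n \<alpha> x / ?Z \<partial>lborel)"
    using w0 Z0 by (subst integral_eq_nn_integral) auto
  finally show ?thesis by simp
qed

lemma weakly_converges_iff_weak_conv_m:
  assumes M: "\<And>n. real_distribution (M n)" and N: "real_distribution N"
  shows "weakly_converges M N \<longleftrightarrow> weak_conv_m M N"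
proof
  assume *: "weakly_converges M N"
  show "weak_conv_m M N"
  proof (rule integral_bdd_continuous_conv_imp_weak_conv[OF M N])
    fix f :: "real \<Rightarrow> real" assume "\<And>x. isCont f x" "\<And>x. \<bar>f x\<bar> \<le> 1"
    then have "f \<in> bdd_cont"
      by (auto simp: bdd_cont_def bounded_iff continuous_at_imp_continuous_on)
    with * show "(\<lambda>n. integral\<^sup>L (M n) f) \<longlonglongrightarrow> integral\<^sup>L N f"
      by (auto simp: weakly_converges_def)
  qed
next
  assume *: "weak_conv_m M N"
  show "weakly_converges M N"
    unfolding weakly_converges_def
  proof
    fix f assume "f \<in> bdd_cont"
    then obtain B where "\<And>x. isCont f x" "\<And>x. norm (f x) \<le> B"
      by (auto simp: bdd_cont_def bounded_iff continuous_on_eq_continuous_at)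
    then show "(\<lambda>n. integral\<^sup>L (M n) f) \<longlonglongrightarrow> integral\<^sup>L N f"
      by (rule weak_conv_imp_integral_bdd_continuous_conv[OF M N *])
  qed
qed

lemma openin_euclid_top_sets:
  assumes "openin (euclid_top n) U"
  shows "U \<in> sets (euclid n)"
proof -
  obtain \<B> :: "real set set" where \<B>: "countable \<B>" "topological_basis \<B>"
    using ex_countable_basis by blast
  let ?F = "{b \<in> {..<n} \<rightarrow>\<^sub>E \<B>. Pi\<^sub>E {..<n} b \<subseteq> U}"
  have F: "countable ?F"
    by (rule countable_subset[of _ "{..<n} \<rightarrow>\<^sub>E \<B>"]) (auto intro!: countable_PiE \<B>)
  have "U = (\<Union>b\<in>?F. Pi\<^sub>E {..<n} b)"
  proof (intro equalityI subsetI)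
    fix x assume "x \<in> U"
    then have "\<exists>W. finite {i \<in> {..<n}. W i \<noteq> topspace euclideanreal} \<and>
        (\<forall>i\<in>{..<n}. openin euclideanreal (W i)) \<and> x \<in> Pi\<^sub>E {..<n} W \<and> Pi\<^sub>E {..<n} W \<subseteq> U"
      using assms unfolding openin_product_topology_alt by blast
    then obtain W where W: "\<forall>i\<in>{..<n}. open (W i)" "x \<in> Pi\<^sub>E {..<n} W" "Pi\<^sub>E {..<n} W \<subseteq> U"
      by (elim exE conjE) (simp only: open_openin)
    have "\<forall>i\<in>{..<n}. \<exists>b\<in>\<B>. x i \<in> b \<and> b \<subseteq> W i"
    proof
      fix i assume "i \<in> {..<n}"
      with W have "open (W i)" "x i \<in> W i" by (auto simp: PiE_iff)
      with \<B>(2) show "\<exists>b\<in>\<B>. x i \<in> b \<and> b \<subseteq> W i" by (metis topological_basisE)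
    qed
    then obtain b where b: "\<And>i. i < n \<Longrightarrow> b i \<in> \<B> \<and> x i \<in> b i \<and> b i \<subseteq> W i"
      by (metis lessThan_iff)
    let ?b = "restrict b {..<n}"
    have "Pi\<^sub>E {..<n} ?b \<subseteq> Pi\<^sub>E {..<n} W" using b by (intro PiE_mono) auto
    then have "?b \<in> ?F" using b W by auto
    moreover have "x \<in> Pi\<^sub>E {..<n} ?b" using b W by (auto simp: PiE_iff)
    ultimately show "x \<in> (\<Union>b\<in>?F. Pi\<^sub>E {..<n} b)" by blast
  qed auto
  moreover have "Pi\<^sub>E {..<n} b \<in> sets (euclid n)" if "b \<in> ?F" for b
    using that \<B>(2) by (intro sets_PiM_I_finite) (auto simp: PiE_iff topological_basis_open)
  ultimately show ?thesis
    using F sets.countable_UN'[of ?F "Pi\<^sub>E {..<n}" "euclid n"] by (simp add: image_subset_iff)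
qed

lemma finite_measure_eqI_bdd_cont:
  assumes M: "finite_measure M" "sets M = sets borel" and N: "finite_measure N" "sets N = sets borel"
    and eq: "\<And>f. f \<in> bdd_cont \<Longrightarrow> integral\<^sup>L M f = integral\<^sup>L N f"
  shows "M = N"
proof -
  have step: "(\<lambda>k. integral\<^sup>L P (cts_step x (x + 1 / Suc k))) \<longlonglongrightarrow> measure P {..x}"
    if P: "finite_measure P" "sets P = sets borel" for P and x :: real
  proof -
    interpret finite_measure P by fact
    have sp: "space P = UNIV" using sets_eq_imp_space_eq[OF P(2)] by simp
    have m: "cts_step x y \<in> borel_measurable P" if "x < y" for y
      using uniformly_continuous_imp_continuous[OF cts_step_uniformly_continuous[OF that]]
      by (simp add: borel_measurable_continuous_onI measurable_cong_sets[OF P(2) refl])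
    have "(\<lambda>k. integral\<^sup>L P (cts_step x (x + 1 / Suc k))) \<longlonglongrightarrow> integral\<^sup>L P (indicator {..x})"
    proof (rule integral_dominated_convergence[where w="\<lambda>_. 1"])
      show "indicator {..x} \<in> borel_measurable P"
        by (intro borel_measurable_indicator) (simp add: P)
      show "AE t in P. (\<lambda>k. cts_step x (x + 1 / real (Suc k)) t) \<longlonglongrightarrow> indicator {..x} t"
      proof (rule AE_I2)
        fix t
        show "(\<lambda>k. cts_step x (x + 1 / real (Suc k)) t) \<longlonglongrightarrow> indicator {..x} t"
        proof (cases "t \<le> x")
          case True then show ?thesis by (simp add: cts_step_def)
        next
          case False
          then have "eventually (\<lambda>k. inverse (real (Suc k)) < t - x) sequentially"
            using LIMSEQ_inverse_real_of_nat by (intro order_tendstoD(2)[of _ 0]) auto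
          then have "eventually (\<lambda>k. cts_step x (x + 1 / real (Suc k)) t = 0) sequentially"
            by eventually_elim (use False in \<open>auto simp: cts_step_def inverse_eq_divide\<close>)
          then show ?thesis using False by (simp add: tendsto_eventually)
        qed
      qed
      show "cts_step x (x + 1 / real (Suc k)) \<in> borel_measurable P" for k by (rule m) simp
      show "AE t in P. norm (cts_step x (x + 1 / real (Suc k)) t) \<le> 1" for k
        by (rule AE_I2) (auto simp: cts_step_def divide_simps)
    qed simp
    then show ?thesis by (simp add: sp)
  qed
  have bc: "cts_step x y \<in> bdd_cont" if "x < y" for x y
    using uniformly_continuous_imp_continuous[OF cts_step_uniformly_continuous[OF that]] that
    by (auto simp: bdd_cont_def bounded_iff cts_step_def divide_simps intro!: exI[of _ 1])
  have "measure M {..x} = measure N {..x}" for x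
    using step[OF M, of x] step[OF N, of x] eq[OF bc] by (auto intro: LIMSEQ_unique)
  then have "cdf M = cdf N" by (auto simp: cdf_def)
  then show ?thesis
    using M N by (intro cdf_unique') (auto simp: finite_borel_measure_def finite_borel_measure_axioms_def)
qed

lemma wcp_cond_prob_unique:
  assumes g: "wcp_cond_prob n \<rho> \<gamma>" and g': "wcp_cond_prob n \<rho> \<gamma>'"
    and y: "y \<in> space (euclid (n - 1))"
  shows "\<gamma> y = \<gamma>' y"
proof (cases "y \<in> measure_support (euclid_top (n - 1)) (other_law n \<rho>)")
  case False
  then show ?thesis using g g' y by (simp add: wcp_cond_prob_def proper_kernel_def)
next
  case supp: True
  show ?thesis
  proof (rule finite_measure_eqI_bdd_cont)
    let ?X = "euclid_top (n - 1)" and ?\<mu> = "other_law n \<rho>"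
    have rg: "regular_cond_prob n \<rho> \<gamma>" and rg': "regular_cond_prob n \<rho> \<gamma>'"
      using g g' by (auto simp: wcp_cond_prob_def)
    have k: "\<gamma> \<in> euclid (n - 1) \<rightarrow>\<^sub>M subprob_algebra borel" "\<gamma>' \<in> euclid (n - 1) \<rightarrow>\<^sub>M subprob_algebra borel"
      using rg rg' by (auto simp: regular_cond_prob_def)
    have fin: "subprob_space (\<gamma> z)" "subprob_space (\<gamma>' z)" "sets (\<gamma> z) = sets borel" "sets (\<gamma>' z) = sets borel"
      if "z \<in> space (euclid (n - 1))" for z
      using k[THEN measurable_space, OF that] by (auto simp: space_subprob_algebra)
    show "finite_measure (\<gamma> y)" "finite_measure (\<gamma>' y)" "sets (\<gamma> y) = sets borel" "sets (\<gamma>' y) = sets borel"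
      using fin[OF y] by (auto simp: subprob_space_def)
    interpret \<rho>: prob_space \<rho> using rg by (simp add: regular_cond_prob_def)
    have "other_spins n \<in> euclid n \<rightarrow>\<^sub>M euclid (n - 1)"
      unfolding other_spins_def[abs_def]
      by (intro measurable_restrict measurable_component_singleton) auto
    then have "other_spins n \<in> \<rho> \<rightarrow>\<^sub>M euclid (n - 1)"
      using rg by (simp add: regular_cond_prob_def cong: measurable_cong_sets)
    then interpret \<mu>: prob_space ?\<mu> by (rule \<rho>.prob_space_distr)
    have "AE z in ?\<mu>. emeasure (\<gamma> z) {..real_of_rat q} = emeasure (\<gamma>' z) {..real_of_rat q}" for q
    proof (rule \<mu>.density_unique_finite_measure)
      show "(\<lambda>z. emeasure (\<gamma> z) {..real_of_rat q}) \<in> borel_measurable ?\<mu>"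
        "(\<lambda>z. emeasure (\<gamma>' z) {..real_of_rat q}) \<in> borel_measurable ?\<mu>"
        using k[THEN measurable_compose, OF measurable_emeasure_subprob_algebra] by simp_all
      fix B assume "B \<in> sets ?\<mu>"
      then have B: "B \<in> sets (euclid (n - 1))" by simp
      have q: "{..real_of_rat q} \<in> sets borel" by simp
      have "(\<integral>\<^sup>+z. indicator B z * emeasure (\<kappa> z) {..real_of_rat q} \<partial>?\<mu>) =
          emeasure \<rho> {x \<in> space \<rho>. x 0 \<in> {..real_of_rat q} \<and> other_spins n x \<in> B}"
        if "regular_cond_prob n \<rho> \<kappa>" for \<kappa>
        using that B q unfolding regular_cond_prob_def by (elim conjE) (drule (1) bspec, drule (1) bspec, rule sym)
      from this[OF rg] this[OF rg']
      have "(\<integral>\<^sup>+z. indicator B z * emeasure (\<gamma> z) {..real_of_rat q} \<partial>?\<mu>) =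
          (\<integral>\<^sup>+z. indicator B z * emeasure (\<gamma>' z) {..real_of_rat q} \<partial>?\<mu>)"
        by (rule trans[OF _ sym])
      then show "(\<integral>\<^sup>+z. emeasure (\<gamma> z) {..real_of_rat q} * indicator B z \<partial>?\<mu>) =
          (\<integral>\<^sup>+z. emeasure (\<gamma>' z) {..real_of_rat q} * indicator B z \<partial>?\<mu>)"
        by (simp add: mult.commute)
    qed auto
    then have "AE z in ?\<mu>. \<forall>q. emeasure (\<gamma> z) {..real_of_rat q} = emeasure (\<gamma>' z) {..real_of_rat q}"
      by (simp add: AE_all_countable)
    then have "AE z in ?\<mu>. \<gamma> z = \<gamma>' z"
    proof (rule AE_mp, intro AE_I2 impI)
      fix z assume "z \<in> space ?\<mu>"
        and q: "\<forall>q. emeasure (\<gamma> z) {..real_of_rat q} = emeasure (\<gamma>' z) {..real_of_rat q}"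
      then have z: "z \<in> space (euclid (n - 1))" by (simp only: space_distr)
      interpret g: finite_measure "\<gamma> z" using fin[OF z] by (simp add: subprob_space_def)
      interpret g': finite_measure "\<gamma>' z" using fin[OF z] by (simp add: subprob_space_def)
      have fb: "finite_borel_measure (\<gamma> z)" "finite_borel_measure (\<gamma>' z)"
        using fin[OF z] by (auto simp: finite_borel_measure_def finite_borel_measure_axioms_def subprob_space_def)
      have "cdf (\<gamma> z) x = cdf (\<gamma>' z) x" for x
      proof -
        have lim: "((\<lambda>t. cdf M t) \<longlongrightarrow> cdf M x) (at_right x)" if "finite_borel_measure M" for M
          using finite_borel_measure.cdf_is_right_cont[OF that] by (simp add: continuous_within)
        obtain s where s: "\<And>i. s i \<in> \<rat>" "\<And>i. x < s i" "s \<longlonglongrightarrow> x"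
        proof -
          have "\<exists>r\<in>\<rat>. x < r \<and> r < x + inverse (real (Suc i))" for i
            by (rule Rats_dense_in_real) simp
          then obtain s where s: "\<And>i. s i \<in> \<rat>" "\<And>i. x < s i" "\<And>i. s i < x + inverse (real (Suc i))"
            by metis
          have "s \<longlonglongrightarrow> x"
          proof (rule tendsto_sandwich[of "\<lambda>_. x" _ _ "\<lambda>i. x + inverse (real (Suc i))"])
            show "(\<lambda>i. x + inverse (real (Suc i))) \<longlonglongrightarrow> x"
              using tendsto_add[OF tendsto_const LIMSEQ_inverse_real_of_nat, of x] by simp
          qed (use s in \<open>auto intro!: always_eventually less_imp_le\<close>)
          with s that show ?thesis by blast
        qed
        have "filterlim s (at_right x) sequentially"
          using s by (auto simp: filterlim_at less_imp_neq[symmetric] intro!: always_eventually)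
        from filterlim_compose[OF lim[OF fb(1)] this] filterlim_compose[OF lim[OF fb(2)] this]
        have "(\<lambda>i. cdf (\<gamma> z) (s i)) \<longlonglongrightarrow> cdf (\<gamma> z) x" "(\<lambda>i. cdf (\<gamma>' z) (s i)) \<longlonglongrightarrow> cdf (\<gamma>' z) x" .
        moreover have "cdf (\<gamma> z) (s i) = cdf (\<gamma>' z) (s i)" for i
          using s(1)[of i] q by (auto simp: cdf_def measure_def elim!: Rats_cases)
        ultimately show ?thesis by (auto intro: LIMSEQ_unique)
      qed
      then have "cdf (\<gamma> z) = cdf (\<gamma>' z)" by auto
      then show "\<gamma> z = \<gamma>' z" by (rule cdf_unique'[OF fb])
    qed
    then obtain N where N: "{z \<in> space ?\<mu>. \<gamma> z \<noteq> \<gamma>' z} \<subseteq> N" "emeasure ?\<mu> N = 0" "N \<in> sets ?\<mu>"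
      by (rule AE_E)
    fix f :: "real \<Rightarrow> real" assume f: "f \<in> bdd_cont"
    show "integral\<^sup>L (\<gamma> y) f = integral\<^sup>L (\<gamma>' y) f"
    proof (rule ccontr)
      assume ne: "integral\<^sup>L (\<gamma> y) f \<noteq> integral\<^sup>L (\<gamma>' y) f"
      let ?d = "\<lambda>z. integral\<^sup>L (\<gamma> z) f - integral\<^sup>L (\<gamma>' z) f"
      let ?D = "{z \<in> topspace ?X. ?d z \<in> - {0}}"
      have "continuous_map ?X euclideanreal ?d"
        using g g' f by (intro continuous_map_diff) (auto simp: wcp_cond_prob_def weakly_continuous_def)
      then have "openin ?X ?D"
        by (rule openin_continuous_map_preimage) (simp add: open_Compl)
      moreover have "y \<in> ?D" using y ne by (simp add: space_PiM)
      ultimately have "emeasure ?\<mu> ?D > 0"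
        using supp by (simp add: measure_support_def)
      moreover have "?D \<subseteq> N" using N(1) by (auto simp: space_PiM)
      then have "emeasure ?\<mu> ?D \<le> 0" using emeasure_mono[OF _ N(3), of ?D] by (simp only: N(2))
      ultimately show False by (meson leD)
    qed
  qed
qed

end

theory Submission
  imports Defs
begin

text \<open>
  Since \<open>m\<^sub>n(t, y) = (n - 1)/n m\<^bsub>n-1\<^esub>(y) + t/n\<close>, the Lebesgue density of \<open>\<nu>\<^sub>n\<close> at \<open>(t, y)\<close> is the kernel
  weight at magnetisation \<open>m\<^bsub>n-1\<^esub>(y)\<close> times a positive function of \<open>y\<close>. So Fubini identifies the
  normalised weight as the conditional law of the first spin, and the law of the other spins has
  full support, which makes properness vacuous. For the limit, multiply the weight by
  \<open>exp (n V(c\<^sub>n))\<close>, \<open>c\<^sub>n = (n - 1)/n \<alpha>\<^sub>n\<close>: the exponent \<open>-n (V(c\<^sub>n + x/n) - V(c\<^sub>n))\<close> tends to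
  \<open>-V'(\<alpha>) x\<close> and is at most \<open>L \<bar>x\<bar>\<close>, so dominated convergence applies to numerator and denominator
  for every bounded measurable test function.
\<close>

subsection \<open>The kernels\<close>

text \<open>Completing the square. With \<open>c\<close> equal to minus the derivative of
  \<open>V\<close>, the left side is the limit of the rescaled weights, so this identifies the limit
  law and gives its normalising constant.\<close>

lemma exp_linear_minus_square:
  "exp (c * x - x\<^sup>2 / 2) = sqrt (2 * pi) * exp (c\<^sup>2 / 2) * normal_density c 1 x"
  by (simp add: normal_density_def exp_add[symmetric] power2_eq_square field_simps)

lemma integrable_exp_linear_minus_square:
  "integrable lborel (\<lambda>x::real. exp (c * x - x\<^sup>2 / 2))"
  unfolding exp_linear_minus_square by simp

text \<open>The factor \<open>exp (c * \<bar>x\<bar>)\<close> is one of \<open>exp (c * x)\<close>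
  and \<open>exp (- c * x)\<close>, hence at most their sum. Functions of this shape serve as
  majorants in both dominated convergence arguments below.\<close>

lemma integrable_exp_abs_minus_square:
  "integrable lborel (\<lambda>x::real. exp (c * \<bar>x\<bar> - x\<^sup>2 / 2))"
proof (rule Bochner_Integration.integrable_bound)
  show "integrable lborel (\<lambda>x::real. exp (c * x - x\<^sup>2 / 2) + exp ((- c) * x - x\<^sup>2 / 2))"
    by (intro Bochner_Integration.integrable_add integrable_exp_linear_minus_square)
  show "AE x in lborel. norm (exp (c * \<bar>x\<bar> - x\<^sup>2 / 2)) \<le> norm (exp (c * x - x\<^sup>2 / 2) + exp ((- c) * x - x\<^sup>2 / 2))"
    by (intro AE_I2) (simp only: real_norm_def abs_exp_cancel abs_of_pos[OF add_pos_pos[OF exp_gt_zero exp_gt_zero]], auto simp: abs_if)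
qed simp

lemma gamma_weight_pos: "0 < gamma_weight V n \<alpha> x"
  by (simp add: gamma_weight_def)

lemma borel_measurable_gamma_weight [measurable (raw)]:
  assumes [measurable]: "V \<in> borel_measurable borel" "f \<in> borel_measurable M" "g \<in> borel_measurable M"
  shows "(\<lambda>x. gamma_weight V n (f x) (g x)) \<in> borel_measurable M"
  unfolding gamma_weight_def by measurable

text \<open>Since \<open>V\<close> is nonnegative, the Gaussian factor alone dominates; it is the
  case \<open>c = 0\<close> of the previous integrals.\<close>

lemma integrable_gamma_weight:
  assumes [measurable]: "V \<in> borel_measurable borel" and "\<And>x. 0 \<le> V x"
  shows "integrable lborel (gamma_weight V n \<alpha>)"
proof (rule Bochner_Integration.integrable_bound)
  show "integrable lborel (\<lambda>x::real. exp (0 * x - x\<^sup>2 / 2))"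
    by (rule integrable_exp_linear_minus_square)
  show "AE x in lborel. norm (gamma_weight V n \<alpha> x) \<le> norm (exp (0 * x - x\<^sup>2 / 2))"
    using assms(2) by (auto simp: gamma_weight_def)
qed measurable

text \<open>A nonnegative integrable function with zero integral vanishes almost everywhere. As
  Lebesgue measure is not null, this is impossible for a function that is positive
  everywhere.\<close>

lemma integral_gamma_weight_pos:
  assumes "V \<in> borel_measurable borel" and "\<And>x. 0 \<le> V x"
  shows "0 < (\<integral>x. gamma_weight V n \<alpha> x \<partial>lborel)"
proof -
  have "\<not> (AE x in lborel :: real measure. gamma_weight V n \<alpha> x = 0)"
    using ae_filter_eq_bot_iff[of "lborel :: real measure"]
    by (simp add: less_imp_neq[OF gamma_weight_pos, symmetric] trivial_limit_def)
  then have "(\<integral>x. gamma_weight V n \<alpha> x \<partial>lborel) \<noteq> 0"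
    by (subst integral_nonneg_eq_0_iff_AE)
      (auto simp: integrable_gamma_weight[OF assms] less_imp_le[OF gamma_weight_pos])
  then show ?thesis
    by (simp add: less_le less_imp_le[OF gamma_weight_pos])
qed

lemma nn_integral_gamma_weight:
  assumes "V \<in> borel_measurable borel" and "\<And>x. 0 \<le> V x"
  shows "(\<integral>\<^sup>+x. ennreal (gamma_weight V n \<alpha> x) \<partial>lborel) = ennreal (\<integral>x. gamma_weight V n \<alpha> x \<partial>lborel)"
  by (rule nn_integral_eq_integral) (auto simp: integrable_gamma_weight[OF assms] less_imp_le[OF gamma_weight_pos])

lemma sets_gamma_bar [simp, measurable_cong]: "sets (gamma_bar V n \<alpha>) = sets borel"
  by (simp add: gamma_bar_def)

lemma space_gamma_bar [simp]: "space (gamma_bar V n \<alpha>) = UNIV"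
  by (simp add: gamma_bar_def)

lemma integral_gamma_bar:
  assumes [measurable]: "V \<in> borel_measurable borel" "f \<in> borel_measurable borel"
  shows "integral\<^sup>L (gamma_bar V n \<alpha>) f =
    (\<integral>x. gamma_weight V n \<alpha> x * f x \<partial>lborel) / (\<integral>x. gamma_weight V n \<alpha> x \<partial>lborel)"
proof -
  have "0 \<le> gamma_weight V n \<alpha> x / (\<integral>t. gamma_weight V n \<alpha> t \<partial>lborel)" for x
    by (simp add: less_imp_le[OF gamma_weight_pos])
  then show ?thesis
    unfolding gamma_bar_def by (subst integral_density) simp_all
qed

text \<open>This clears the denominator in \<open>gamma_bar\<close>: under the unnormalised weight,
  the indicator of \<open>A\<close> may be replaced by the constant
  \<open>emeasure (gamma_bar V n \<alpha>) A\<close>. The conditional probability identity uses it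
  in this form.\<close>

lemma nn_integral_gamma_weight_times:
  assumes [measurable]: "V \<in> borel_measurable borel" and V0: "\<And>x. 0 \<le> V x"
    and A[measurable]: "A \<in> sets borel"
  shows "(\<integral>\<^sup>+x. ennreal (gamma_weight V n \<alpha> x) * indicator A x \<partial>lborel) =
    emeasure (gamma_bar V n \<alpha>) A * (\<integral>\<^sup>+x. ennreal (gamma_weight V n \<alpha> x) \<partial>lborel)"
proof -
  let ?Z = "\<integral>x. gamma_weight V n \<alpha> x \<partial>lborel"
  have Z: "0 < ?Z" by (rule integral_gamma_weight_pos) fact+
  have "emeasure (gamma_bar V n \<alpha>) A * ennreal ?Z =
      (\<integral>\<^sup>+x. ennreal (gamma_weight V n \<alpha> x / ?Z) * indicator A x * ennreal ?Z \<partial>lborel)"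
    unfolding gamma_bar_def by (subst emeasure_density) (simp_all add: nn_integral_multc)
  also have "\<dots> = (\<integral>\<^sup>+x. ennreal (gamma_weight V n \<alpha> x) * indicator A x \<partial>lborel)"
    using Z by (intro nn_integral_cong) (auto simp: ennreal_mult''[symmetric] split: split_indicator)
  finally show ?thesis
    by (simp add: nn_integral_gamma_weight[OF assms(1,2)])
qed

lemma prob_space_gamma_bar:
  assumes "V \<in> borel_measurable borel" and "\<And>x. 0 \<le> V x"
  shows "prob_space (gamma_bar V n \<alpha>)"
proof
  note [measurable] = assms(1)
  let ?Z = "\<integral>x. gamma_weight V n \<alpha> x \<partial>lborel"
  have Z: "0 < ?Z" by (rule integral_gamma_weight_pos) fact+
  have "emeasure (gamma_bar V n \<alpha>) UNIV = (\<integral>\<^sup>+x. ennreal (gamma_weight V n \<alpha> x / ?Z) \<partial>lborel)"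
    unfolding gamma_bar_def by (subst emeasure_density) simp_all
  also have "\<dots> = ennreal (\<integral>x. gamma_weight V n \<alpha> x / ?Z \<partial>lborel)"
    using Z by (intro nn_integral_eq_integral)
      (auto simp: integrable_gamma_weight[OF assms] less_imp_le[OF gamma_weight_pos])
  finally show "emeasure (gamma_bar V n \<alpha>) (space (gamma_bar V n \<alpha>)) = 1"
    using Z by simp
qed

text \<open>The weight is jointly measurable in \<alpha> and \<open>x\<close>, so its parameter
  integrals are measurable in \<alpha>; evaluation on each Borel set is such an integral.\<close>

lemma measurable_gamma_bar:
  assumes V[measurable]: "V \<in> borel_measurable borel" and V0: "\<And>x. 0 \<le> V x"
  shows "gamma_bar V n \<in> borel \<rightarrow>\<^sub>M subprob_algebra borel"
proof (rule measurable_subprob_algebra)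
  fix A :: "real set" assume [measurable]: "A \<in> sets borel"
  have "(\<lambda>\<alpha>. \<integral>\<^sup>+x. ennreal (gamma_weight V n \<alpha> x / (\<integral>t. gamma_weight V n \<alpha> t \<partial>lborel)) * indicator A x \<partial>lborel)
      \<in> borel_measurable borel"
    by measurable
  then show "(\<lambda>\<alpha>. emeasure (gamma_bar V n \<alpha>) A) \<in> borel_measurable borel"
    by (subst measurable_cong[where g = "\<lambda>\<alpha>. \<integral>\<^sup>+x. ennreal (gamma_weight V n \<alpha> x / (\<integral>t. gamma_weight V n \<alpha> t \<partial>lborel)) * indicator A x \<partial>lborel"])
      (simp_all add: gamma_bar_def emeasure_density)
qed (auto intro!: prob_space_imp_subprob_space prob_space_gamma_bar assms)

text \<open>As \<open>V\<close> is merely measurable, the translation \<open>x = t - (n - 1) \<alpha>\<close> moves the dependence on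
  \<open>\<alpha>\<close> from \<open>V\<close> to the test function and the Gaussian.\<close>

lemma tendsto_integral_gamma_weight:
  assumes V[measurable]: "V \<in> borel_measurable borel" and V0: "\<And>x. 0 \<le> V x" and n: "n \<ge> 1"
    and f: "f \<in> bdd_cont" and a: "a \<longlonglongrightarrow> \<alpha>"
  shows "(\<lambda>k. \<integral>x. gamma_weight V n (a k) x * f x \<partial>lborel) \<longlonglongrightarrow> (\<integral>x. gamma_weight V n \<alpha> x * f x \<partial>lborel)"
proof -
  define c where "c = real n - 1"
  have c: "0 \<le> c" using n by (simp add: c_def)
  let ?w = "\<lambda>\<beta> t. exp (- (real n * V (t / real n))) * exp (- (t - c * \<beta>)\<^sup>2 / 2) * f (t - c * \<beta>)"
  have shift: "(\<integral>x. gamma_weight V n \<beta> x * f x \<partial>lborel) = (\<integral>t. ?w \<beta> t \<partial>lborel)" for \<beta>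
  proof -
    have eq: "(real n - 1) / real n * \<beta> + (t - c * \<beta>) / real n = t / real n" for t
      using n by (simp add: c_def field_simps)
    show ?thesis
      by (subst lborel_integral_real_affine[of 1 _ "- (c * \<beta>)"])
        (simp_all only: gamma_weight_def eq abs_one one_neq_zero not_False_eq_True scaleR_one mult_1
          add.commute[of "- (c * \<beta>)"] uminus_add_conv_diff)
  qed
  have f_cont: "continuous_on UNIV f" using f by (simp add: bdd_cont_def)
  then have [measurable]: "f \<in> borel_measurable borel" by (rule borel_measurable_continuous_onI)
  obtain B where B: "\<And>x. \<bar>f x\<bar> \<le> B" using f by (auto simp: bdd_cont_def bounded_iff)
  \<comment> \<open>A convergent sequence is bounded; \<open>R\<close> makes the majorant
    independent of \<open>k\<close>.\<close>
  obtain R where R: "\<And>k. \<bar>a k\<bar> \<le> R"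
    using convergent_imp_Bseq[of a] a by (auto simp: convergent_def Bseq_def)
  have "(\<lambda>k. \<integral>t. ?w (a k) t \<partial>lborel) \<longlonglongrightarrow> (\<integral>t. ?w \<alpha> t \<partial>lborel)"
  proof (rule integral_dominated_convergence)
    show "integrable lborel (\<lambda>t. B * exp ((c * R) * \<bar>t\<bar> - t\<^sup>2 / 2))"
      by (intro Bochner_Integration.integrable_mult_right integrable_exp_abs_minus_square)
    show "AE t in lborel. (\<lambda>k. ?w (a k) t) \<longlonglongrightarrow> ?w \<alpha> t"
    proof (rule AE_I2)
      fix t
      have "(\<lambda>k. f (t - c * a k)) \<longlonglongrightarrow> f (t - c * \<alpha>)"
        by (rule continuous_on_tendsto_compose[OF f_cont]) (auto intro!: tendsto_intros a)
      then show "(\<lambda>k. ?w (a k) t) \<longlonglongrightarrow> ?w \<alpha> t"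
        by (intro tendsto_intros a) auto
    qed
    show "AE t in lborel. norm (?w (a k) t) \<le> B * exp ((c * R) * \<bar>t\<bar> - t\<^sup>2 / 2)" for k
    proof (rule AE_I2)
      fix t
      have "t * (c * a k) \<le> \<bar>t * (c * a k)\<bar>" by simp
      also have "\<dots> \<le> (c * R) * \<bar>t\<bar>"
        using mult_left_mono[OF R[of k], of "\<bar>t\<bar> * c"] c by (simp add: abs_mult mult_ac)
      finally have "t * (c * a k) \<le> (c * R) * \<bar>t\<bar>" .
      moreover have "(t - c * a k)\<^sup>2 = t\<^sup>2 + (c * a k)\<^sup>2 - 2 * (t * (c * a k))"
        by (simp add: power2_diff)
      ultimately have "- (t - c * a k)\<^sup>2 / 2 \<le> (c * R) * \<bar>t\<bar> - t\<^sup>2 / 2"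
        using zero_le_power2[of "c * a k"] by argo
      then have "exp (- (t - c * a k)\<^sup>2 / 2) \<le> exp ((c * R) * \<bar>t\<bar> - t\<^sup>2 / 2)" by simp
      moreover have "exp (- (real n * V (t / real n))) \<le> 1" using V0 by simp
      ultimately have "exp (- (real n * V (t / real n))) * exp (- (t - c * a k)\<^sup>2 / 2) \<le>
          1 * exp ((c * R) * \<bar>t\<bar> - t\<^sup>2 / 2)"
        by (intro mult_mono) auto
      then have "(exp (- (real n * V (t / real n))) * exp (- (t - c * a k)\<^sup>2 / 2)) * \<bar>f (t - c * a k)\<bar>
          \<le> exp ((c * R) * \<bar>t\<bar> - t\<^sup>2 / 2) * B"
        using B[of "t - c * a k"] by (intro mult_mono) auto
      then show "norm (?w (a k) t) \<le> B * exp ((c * R) * \<bar>t\<bar> - t\<^sup>2 / 2)"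
        by (simp add: abs_mult mult.commute)
    qed
  qed measurable
  then show ?thesis by (simp add: shift)
qed

lemma continuous_gamma_bar:
  assumes V[measurable]: "V \<in> borel_measurable borel" and V0: "\<And>x. 0 \<le> V x" and n: "n \<ge> 1"
    and f: "f \<in> bdd_cont"
  shows "continuous_on UNIV (\<lambda>\<alpha>. integral\<^sup>L (gamma_bar V n \<alpha>) f)"
proof (rule continuous_on_sequentiallyI)
  fix a \<alpha> assume a: "a \<longlonglongrightarrow> (\<alpha>::real)"
  have [measurable]: "f \<in> borel_measurable borel"
    using f by (auto simp: bdd_cont_def intro: borel_measurable_continuous_onI)
  \<comment> \<open>The constant test function turns the convergence of numerators into that of
    denominators.\<close>
  have "(\<lambda>_. 1) \<in> bdd_cont" by (simp add: bdd_cont_def)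
  from tendsto_integral_gamma_weight[OF V V0 n f a] tendsto_integral_gamma_weight[OF V V0 n this a]
  show "(\<lambda>k. integral\<^sup>L (gamma_bar V n (a k)) f) \<longlonglongrightarrow> integral\<^sup>L (gamma_bar V n \<alpha>) f"
    using integral_gamma_weight_pos[OF V V0, of n \<alpha>]
    by (auto simp: integral_gamma_bar intro!: tendsto_divide)
qed

subsection \<open>Splitting off the first spin\<close>

text \<open>Inverse of the splitting of a configuration into its spin at \<open>0\<close> and its
  \<open>other_spins\<close>. The restriction keeps the result in the extensional functions that
  form the product space.\<close>

definition cons_spin :: "nat \<Rightarrow> (nat \<Rightarrow> 'a) \<Rightarrow> 'a \<Rightarrow> nat \<Rightarrow> 'a" where
  "cons_spin m y t = (\<lambda>i\<in>{..<Suc m}. case i of 0 \<Rightarrow> t | Suc j \<Rightarrow> y j)"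

lemma cons_spin_0 [simp]: "cons_spin m y t 0 = t"
  by (simp add: cons_spin_def)

lemma cons_spin_Suc [simp]: "j < m \<Longrightarrow> cons_spin m y t (Suc j) = y j"
  by (simp add: cons_spin_def)

lemma cons_spin_extensional: "cons_spin m y t \<in> extensional {..<Suc m}"
  by (simp add: cons_spin_def)

lemma other_spins_cons_spin:
  "y \<in> extensional {..<m} \<Longrightarrow> other_spins (Suc m) (cons_spin m y t) = y"
  by (auto simp: other_spins_def fun_eq_iff extensional_def)

lemma measurable_cons_spin [measurable]:
  "(\<lambda>(y, t). cons_spin m y t) \<in> PiM {..<m} (\<lambda>_. M) \<Otimes>\<^sub>M M \<rightarrow>\<^sub>M PiM {..<Suc m} (\<lambda>_. M)"
proof -
  have "(\<lambda>p. case i of 0 \<Rightarrow> snd p | Suc j \<Rightarrow> fst p j) \<in> PiM {..<m} (\<lambda>_. M) \<Otimes>\<^sub>M M \<rightarrow>\<^sub>M M"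
    if "i \<in> {..<Suc m}" for i
  proof (cases i)
    case (Suc j)
    with that have "(\<lambda>y. y j) \<in> PiM {..<m} (\<lambda>_. M) \<rightarrow>\<^sub>M M"
      by (intro measurable_component_singleton) simp
    from measurable_compose[OF measurable_fst this] show ?thesis by (simp add: Suc)
  qed simp
  then show ?thesis
    unfolding cons_spin_def split_beta' by (rule measurable_restrict)
qed

lemma measurable_other_spins [measurable]:
  "other_spins (Suc m) \<in> PiM {..<Suc m} (\<lambda>_. M) \<rightarrow>\<^sub>M PiM {..<m} (\<lambda>_. M :: real measure)"
  unfolding other_spins_def[abs_def] diff_Suc_1
  by (intro measurable_restrict measurable_component_singleton) auto

text \<open>A product measure is determined by its values on boxes, and the preimage of a box under
  \<open>cons_spin\<close> is again a box, with the side at \<open>0\<close> split off and the other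
  indices shifted.\<close>

lemma PiM_lessThan_Suc_eq_distr:
  assumes "sigma_finite_measure M"
  shows "PiM {..<Suc m} (\<lambda>_. M) =
    distr (PiM {..<m} (\<lambda>_. M) \<Otimes>\<^sub>M M) (PiM {..<Suc m} (\<lambda>_. M)) (\<lambda>(y, t). cons_spin m y t)"
proof -
  interpret M: sigma_finite_measure M by fact
  interpret product_sigma_finite "\<lambda>_::nat. M" by (simp add: product_sigma_finite_def assms)
  show ?thesis
  proof (rule PiM_eqI[symmetric])
    fix A :: "nat \<Rightarrow> 'a set" assume A: "\<And>i. i \<in> {..<Suc m} \<Longrightarrow> A i \<in> sets M"
    have "(\<lambda>(y, t). cons_spin m y t) -` Pi\<^sub>E {..<Suc m} A \<inter> space (PiM {..<m} (\<lambda>_. M) \<Otimes>\<^sub>M M) =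
        Pi\<^sub>E {..<m} (\<lambda>i. A (Suc i)) \<times> A 0"
      (is "?L = ?R")
    proof (rule set_eqI)
      fix p :: "(nat \<Rightarrow> 'a) \<times> 'a"
      obtain y t where p: "p = (y, t)" by (cases p)
      have "cons_spin m y t \<in> Pi\<^sub>E {..<Suc m} A \<longleftrightarrow> t \<in> A 0 \<and> (\<forall>i<m. y i \<in> A (Suc i))"
        by (simp add: PiE_iff Ball_def All_less_Suc2 cons_spin_extensional)
      \<comment> \<open>The preimage is taken within the product space, so membership in the sides
        must also imply membership in \<open>space M\<close>.\<close>
      moreover have "A 0 \<subseteq> space M" "\<forall>i<m. A (Suc i) \<subseteq> space M"
        using A[THEN sets.sets_into_space] by simp_all
      then have "t \<in> A 0 \<Longrightarrow> t \<in> space M" "\<And>i. i < m \<Longrightarrow> y i \<in> A (Suc i) \<Longrightarrow> y i \<in> space M"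
        by blast+
      ultimately show "p \<in> ?L \<longleftrightarrow> p \<in> ?R"
        unfolding p by (auto simp: space_pair_measure space_PiM PiE_iff)
    qed
    then show "emeasure (distr (PiM {..<m} (\<lambda>_. M) \<Otimes>\<^sub>M M) (PiM {..<Suc m} (\<lambda>_. M)) (\<lambda>(y, t). cons_spin m y t))
        (Pi\<^sub>E {..<Suc m} A) = (\<Prod>i<Suc m. emeasure M (A i))"
      using A emeasure_PiM[of "{..<m}" "\<lambda>i. A (Suc i)"]
      by (simp add: emeasure_distr sets_PiM_I_finite M.emeasure_pair_measure_Times
          prod.lessThan_Suc_shift mult.commute del: prod.lessThan_Suc)
  qed simp_all
qed

text \<open>Tonelli's theorem with the first spin integrated innermost, so that the other spins are
  fixed while its conditional law is computed.\<close>

lemma nn_integral_PiM_lessThan_Suc: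
  assumes "sigma_finite_measure M" and [measurable]: "f \<in> borel_measurable (PiM {..<Suc m} (\<lambda>_. M))"
  shows "(\<integral>\<^sup>+x. f x \<partial>PiM {..<Suc m} (\<lambda>_. M)) = (\<integral>\<^sup>+y. \<integral>\<^sup>+t. f (cons_spin m y t) \<partial>M \<partial>PiM {..<m} (\<lambda>_. M))"
proof -
  interpret M: sigma_finite_measure M by fact
  show ?thesis
    by (subst PiM_lessThan_Suc_eq_distr[OF assms(1)])
      (simp add: nn_integral_distr M.nn_integral_fst[symmetric])
qed

text \<open>The right side is the argument of \<open>V\<close> in \<open>gamma_weight\<close>. This
  is why the first spin depends on the others only through their magnetisation.\<close>

lemma mag_cons_spin:
  assumes "1 \<le> m"
  shows "mag (Suc m) (cons_spin m y t) = (real (Suc m) - 1) / real (Suc m) * mag m y + t / real (Suc m)"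
  using assms unfolding mag_def by (subst sum.lessThan_Suc_shift) (simp add: add_divide_distrib)

section \<open>Disintegration of the Gibbs measures\<close>

lemma measurable_mag [measurable]: "mag n \<in> borel_measurable (PiM {..<n} (\<lambda>_. borel))"
  unfolding mag_def[abs_def] by measurable

lemma sets_PiM_lborel: "sets (PiM I (\<lambda>_. lborel :: real measure)) = sets (PiM I (\<lambda>_. borel))"
  by (rule sets_PiM_cong) simp_all

lemma prob_space_std_gaussian: "prob_space (std_gaussian n)"
  unfolding std_gaussian_eq_PiM by (intro prob_space_PiM prob_space_normal_density) simp

lemma sets_std_gaussian [measurable_cong]: "sets (std_gaussian n) = sets (euclid n)"
  by (simp add: std_gaussian_def sets_PiM_lborel)

lemma integrable_gibbs_weight:
  assumes [measurable]: "V \<in> borel_measurable borel" and "\<And>x. 0 \<le> V x"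
  shows "integrable (std_gaussian n) (\<lambda>x. exp (- (real n * V (mag n x))))"
proof -
  interpret prob_space "std_gaussian n" by (rule prob_space_std_gaussian)
  show ?thesis
    using assms(2) by (intro integrable_const_bound[where B = 1]) auto
qed

text \<open>A strictly positive integrable function has strictly positive integral on a probability
  space.\<close>

lemma gibbs_Z_pos:
  assumes "V \<in> borel_measurable borel" and "\<And>x. 0 \<le> V x"
  shows "0 < gibbs_Z V n"
proof -
  interpret prob_space "std_gaussian n" by (rule prob_space_std_gaussian)
  show ?thesis
    unfolding gibbs_Z_def
    using integral_less_AE_space[of "\<lambda>_. 0" "\<lambda>x. exp (- (real n * V (mag n x)))"]
    by (simp add: integrable_gibbs_weight[OF assms] emeasure_space_1)
qed

lemma sets_gibbs [simp, measurable_cong]: "sets (gibbs V n) = sets (euclid n)"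
  by (simp add: gibbs_def sets_std_gaussian)

lemma prob_space_gibbs:
  assumes [measurable]: "V \<in> borel_measurable borel" and V0: "\<And>x. 0 \<le> V x"
  shows "prob_space (gibbs V n)"
proof
  have Z: "0 < gibbs_Z V n" by (rule gibbs_Z_pos) fact+
  have "emeasure (gibbs V n) (space (gibbs V n)) =
      (\<integral>\<^sup>+x. ennreal (exp (- (real n * V (mag n x))) / gibbs_Z V n) \<partial>std_gaussian n)"
    unfolding gibbs_def space_density
    by (subst emeasure_density) (auto intro!: nn_integral_cong simp: indicator_def)
  also have "\<dots> = ennreal (\<integral>x. exp (- (real n * V (mag n x))) / gibbs_Z V n \<partial>std_gaussian n)"
    using Z by (intro nn_integral_eq_integral) (auto simp: integrable_gibbs_weight[OF assms])
  also have "\<dots> = 1" using Z by (simp add: gibbs_Z_def)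
  finally show "emeasure (gibbs V n) (space (gibbs V n)) = 1" .
qed

text \<open>The part of the Lebesgue density of \<open>gibbs V (Suc m)\<close> that is free of the
  first spin. The exponent \<open>Suc m\<close> is intended: the Gaussian constant of the first spin
  is collected here because \<open>gamma_weight\<close> omits it.\<close>

definition other_weight :: "(real \<Rightarrow> real) \<Rightarrow> nat \<Rightarrow> (nat \<Rightarrow> real) \<Rightarrow> real" where
  "other_weight V m y = exp (- (\<Sum>i<m. (y i)\<^sup>2) / 2) / sqrt (2 * pi) ^ Suc m / gibbs_Z V (Suc m)"

lemma borel_measurable_other_weight [measurable]:
  "other_weight V m \<in> borel_measurable (PiM {..<m} (\<lambda>_. lborel))"
  unfolding other_weight_def[abs_def] by measurable

text \<open>The Gaussian exponent is additive over spins and the interaction sees only the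
  magnetisation, so the density factors into \<open>other_weight\<close> times
  \<open>gamma_weight\<close>. Both the conditional probability identity and the full support follow
  from this formula.\<close>

lemma nn_integral_gibbs:
  assumes V[measurable]: "V \<in> borel_measurable borel" and V0: "\<And>x. 0 \<le> V x" and m: "1 \<le> m"
    and [measurable]: "f \<in> borel_measurable (euclid (Suc m))"
  shows "(\<integral>\<^sup>+x. f x \<partial>gibbs V (Suc m)) =
    (\<integral>\<^sup>+y. ennreal (other_weight V m y) *
      (\<integral>\<^sup>+t. ennreal (gamma_weight V (Suc m) (mag m y) t) * f (cons_spin m y t) \<partial>lborel) \<partial>PiM {..<m} (\<lambda>_. lborel))"
proof -
  let ?d = "\<lambda>x. ennreal (exp (- (\<Sum>i<Suc m. (x i)\<^sup>2) / 2) / sqrt (2 * pi) ^ Suc m)"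
    and ?e = "\<lambda>x. ennreal (exp (- (real (Suc m) * V (mag (Suc m) x))) / gibbs_Z V (Suc m))"
  have Z: "0 < gibbs_Z V (Suc m)" by (rule gibbs_Z_pos) fact+
  have [measurable]: "f \<in> borel_measurable (PiM {..<Suc m} (\<lambda>_. lborel))"
    by (simp cong: measurable_cong_sets add: sets_PiM_lborel)
  have fm: "f \<in> borel_measurable (std_gaussian (Suc m))"
    by (simp cong: measurable_cong_sets add: sets_std_gaussian)
  have "(\<integral>\<^sup>+x. f x \<partial>gibbs V (Suc m)) = (\<integral>\<^sup>+x. ?e x * f x \<partial>std_gaussian (Suc m))"
    unfolding gibbs_def using fm by (subst nn_integral_density) auto
  also have "\<dots> = (\<integral>\<^sup>+x. ?d x * (?e x * f x) \<partial>PiM {..<Suc m} (\<lambda>_. lborel))"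
    unfolding std_gaussian_def by (subst nn_integral_density) measurable
  also have "\<dots> = (\<integral>\<^sup>+y. \<integral>\<^sup>+t. ?d (cons_spin m y t) * (?e (cons_spin m y t) * f (cons_spin m y t)) \<partial>lborel \<partial>PiM {..<m} (\<lambda>_. lborel))"
    by (rule nn_integral_PiM_lessThan_Suc) (simp_all add: lborel.sigma_finite_measure_axioms)
  also have "\<dots> = (\<integral>\<^sup>+y. \<integral>\<^sup>+t. ennreal (other_weight V m y) * (ennreal (gamma_weight V (Suc m) (mag m y) t) * f (cons_spin m y t)) \<partial>lborel \<partial>PiM {..<m} (\<lambda>_. lborel))"
  proof (intro nn_integral_cong)
    fix y :: "nat \<Rightarrow> real" and t :: real
    let ?S = "\<Sum>i<m. (y i)\<^sup>2"
    have "exp (- (t\<^sup>2 + ?S) / 2) = exp (- ?S / 2) * exp (- t\<^sup>2 / 2)"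
      by (simp add: exp_add[symmetric] field_simps)
    moreover have "(\<Sum>i<Suc m. (cons_spin m y t i)\<^sup>2) = t\<^sup>2 + ?S"
      by (subst sum.lessThan_Suc_shift) simp
    ultimately have "?d (cons_spin m y t) * ?e (cons_spin m y t) =
        ennreal (other_weight V m y) * ennreal (gamma_weight V (Suc m) (mag m y) t)"
      unfolding mag_cons_spin[OF m] gamma_weight_def other_weight_def using Z
      by (simp only: ennreal_mult''[symmetric] exp_ge_zero mult_nonneg_nonneg divide_nonneg_nonneg less_imp_le)
        (simp add: mult_ac)
    then show "?d (cons_spin m y t) * (?e (cons_spin m y t) * f (cons_spin m y t)) =
        ennreal (other_weight V m y) * (ennreal (gamma_weight V (Suc m) (mag m y) t) * f (cons_spin m y t))"
      by (simp only: mult.assoc[symmetric])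
  qed
  also have "\<dots> = (\<integral>\<^sup>+y. ennreal (other_weight V m y) *
      (\<integral>\<^sup>+t. ennreal (gamma_weight V (Suc m) (mag m y) t) * f (cons_spin m y t) \<partial>lborel) \<partial>PiM {..<m} (\<lambda>_. lborel))"
  proof (intro nn_integral_cong nn_integral_cmult)
    fix y assume [measurable]: "y \<in> space (PiM {..<m} (\<lambda>_. lborel :: real measure))"
    \<comment> \<open>Written as a section of the jointly measurable map, so that measurability in
      \<open>t\<close> for fixed \<open>y\<close> is found automatically.\<close>
    have "(\<lambda>t. f ((\<lambda>(y, t). cons_spin m y t) (y, t))) \<in> borel_measurable lborel"
      by measurable
    then show "(\<lambda>t. ennreal (gamma_weight V (Suc m) (mag m y) t) * f (cons_spin m y t)) \<in> borel_measurable lborel"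
      by simp
  qed
  finally show ?thesis .
qed

text \<open>Both sides become iterated integrals by \<open>nn_integral_gibbs\<close>. For fixed
  \<open>y\<close> the inner integrals agree, since averaging the indicator of \<open>A\<close>
  against the weight gives \<open>gamma_bar\<close> times the total weight.\<close>

lemma regular_cond_prob_gibbs:
  assumes V[measurable]: "V \<in> borel_measurable borel" and V0: "\<And>x. 0 \<le> V x" and m: "1 \<le> m"
  shows "regular_cond_prob (Suc m) (gibbs V (Suc m)) (\<lambda>v. gamma_bar V (Suc m) (mag m v))"
  unfolding regular_cond_prob_def
proof (intro conjI ballI)
  let ?\<rho> = "gibbs V (Suc m)" and ?\<gamma> = "\<lambda>v. gamma_bar V (Suc m) (mag m v)"
  have kernel: "?\<gamma> \<in> euclid m \<rightarrow>\<^sub>M subprob_algebra borel"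
    by (rule measurable_compose[OF measurable_mag measurable_gamma_bar]) fact+
  then show "?\<gamma> \<in> euclid (Suc m - 1) \<rightarrow>\<^sub>M subprob_algebra borel" by simp
  fix A B assume A[measurable]: "A \<in> sets (borel :: real measure)" and B: "B \<in> sets (euclid (Suc m - 1))"
  from B have [measurable]: "B \<in> sets (euclid m)" by simp
  let ?E = "{x \<in> space ?\<rho>. x 0 \<in> A \<and> other_spins (Suc m) x \<in> B}"
  have sp: "space ?\<rho> = space (euclid (Suc m))" by (rule sets_eq_imp_space_eq) simp
  have x0[measurable]: "(\<lambda>x. x 0) \<in> euclid (Suc m) \<rightarrow>\<^sub>M borel"
    by (rule measurable_component_singleton) simp
  have E: "?E \<in> sets (euclid (Suc m))" unfolding sp by measurable
  have meas: "(\<lambda>y. emeasure (?\<gamma> y) A) \<in> borel_measurable (euclid m)"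
    by (rule measurable_compose[OF kernel measurable_emeasure_subprob_algebra]) fact
  have space_cons: "cons_spin m y t \<in> space (euclid (Suc m))" for y t
    by (simp add: space_PiM cons_spin_def)
  have "emeasure ?\<rho> ?E = (\<integral>\<^sup>+x. indicator ?E x \<partial>?\<rho>)"
    using E by (subst nn_integral_indicator) simp_all
  also have "\<dots> = (\<integral>\<^sup>+y. ennreal (other_weight V m y) *
      (\<integral>\<^sup>+t. ennreal (gamma_weight V (Suc m) (mag m y) t) * indicator ?E (cons_spin m y t) \<partial>lborel) \<partial>PiM {..<m} (\<lambda>_. lborel))"
    using E by (intro nn_integral_gibbs assms) simp
  \<comment> \<open>The new integrand is written as a function of the whole configuration, so that
    \<open>nn_integral_gibbs\<close> can be applied backwards in the next step.\<close>
  also have "\<dots> = (\<integral>\<^sup>+y. ennreal (other_weight V m y) *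
      (\<integral>\<^sup>+t. ennreal (gamma_weight V (Suc m) (mag m y) t) *
        (indicator B (other_spins (Suc m) (cons_spin m y t)) * emeasure (?\<gamma> (other_spins (Suc m) (cons_spin m y t))) A)
      \<partial>lborel) \<partial>PiM {..<m} (\<lambda>_. lborel))"
  proof (rule nn_integral_cong, rule arg_cong2[where f = "(*)", OF refl])
    fix y assume "y \<in> space (PiM {..<m} (\<lambda>_. lborel :: real measure))"
    then have "y \<in> extensional {..<m}" by (simp add: space_PiM PiE_iff)
    then have o: "other_spins (Suc m) (cons_spin m y t) = y" for t by (rule other_spins_cons_spin)
    have "(\<integral>\<^sup>+t. ennreal (gamma_weight V (Suc m) (mag m y) t) * indicator ?E (cons_spin m y t) \<partial>lborel) =
        (\<integral>\<^sup>+t. indicator B y * (ennreal (gamma_weight V (Suc m) (mag m y) t) * indicator A t) \<partial>lborel)"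
      by (intro nn_integral_cong) (auto simp: o sp space_cons split: split_indicator)
    also have "\<dots> = indicator B y * (emeasure (?\<gamma> y) A * (\<integral>\<^sup>+t. ennreal (gamma_weight V (Suc m) (mag m y) t) \<partial>lborel))"
      by (subst nn_integral_cmult) (simp_all add: nn_integral_gamma_weight_times[OF assms(1,2)])
    also have "\<dots> = (\<integral>\<^sup>+t. ennreal (gamma_weight V (Suc m) (mag m y) t) * (indicator B y * emeasure (?\<gamma> y) A) \<partial>lborel)"
      by (subst nn_integral_multc) (simp_all add: mult_ac)
    finally show "(\<integral>\<^sup>+t. ennreal (gamma_weight V (Suc m) (mag m y) t) * indicator ?E (cons_spin m y t) \<partial>lborel) =
      (\<integral>\<^sup>+t. ennreal (gamma_weight V (Suc m) (mag m y) t) *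
        (indicator B (other_spins (Suc m) (cons_spin m y t)) * emeasure (?\<gamma> (other_spins (Suc m) (cons_spin m y t))) A) \<partial>lborel)"
      by (simp only: o)
  qed
  also have "\<dots> = (\<integral>\<^sup>+x. indicator B (other_spins (Suc m) x) * emeasure (?\<gamma> (other_spins (Suc m) x)) A \<partial>?\<rho>)"
    by (rule nn_integral_gibbs[symmetric, OF assms], intro borel_measurable_times_ennreal
        measurable_compose[OF measurable_other_spins meas]
        measurable_compose[OF measurable_other_spins borel_measurable_indicator]) simp
  also have "\<dots> = (\<integral>\<^sup>+y. indicator B y * emeasure (?\<gamma> y) A \<partial>distr ?\<rho> (euclid m) (other_spins (Suc m)))"
    using meas by (intro nn_integral_distr[symmetric]) (simp_all cong: measurable_cong_sets)
  finally show "emeasure ?\<rho> ?E = (\<integral>\<^sup>+y. indicator B y * emeasure (?\<gamma> y) A \<partial>other_law (Suc m) ?\<rho>)"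
    by simp
qed (simp_all add: prob_space_gibbs[OF assms(1,2)])

section \<open>Full support, properness and weak continuity\<close>

text \<open>A neighbourhood of \<open>y\<close> contains a box with nonempty open sides, each of
  positive Lebesgue measure.\<close>

lemma emeasure_PiM_lborel_open_pos:
  assumes U: "openin (euclid_top m) U" and y: "y \<in> U"
  shows "emeasure (PiM {..<m} (\<lambda>_. lborel)) U \<noteq> 0"
proof -
  interpret product_sigma_finite "\<lambda>_::nat. lborel :: real measure" ..
  have "\<exists>W. finite {i \<in> {..<m}. W i \<noteq> topspace euclideanreal} \<and>
      (\<forall>i\<in>{..<m}. openin euclideanreal (W i)) \<and> y \<in> Pi\<^sub>E {..<m} W \<and> Pi\<^sub>E {..<m} W \<subseteq> U"
    using assms unfolding openin_product_topology_alt by blast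
  then obtain W where W: "\<forall>i\<in>{..<m}. open (W i)" "y \<in> Pi\<^sub>E {..<m} W" "Pi\<^sub>E {..<m} W \<subseteq> U"
    by (elim exE conjE) (simp only: open_openin)
  have Wi: "emeasure lborel (W i) \<noteq> 0" if "i < m" for i
  proof -
    have "open (W i)" "W i \<noteq> {}" using W that by (auto simp: PiE_iff)
    then show ?thesis using open_not_negligible[of "W i"]
      by (auto simp: negligible_iff_emeasure0)
  qed
  have "emeasure (PiM {..<m} (\<lambda>_. lborel)) (Pi\<^sub>E {..<m} W) = (\<Prod>i<m. emeasure lborel (W i))"
    using W by (intro emeasure_PiM) auto
  also have "\<dots> \<noteq> 0" using Wi by simp
  finally have "emeasure (PiM {..<m} (\<lambda>_. lborel)) (Pi\<^sub>E {..<m} W) \<noteq> 0" .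
  moreover have "emeasure (PiM {..<m} (\<lambda>_. lborel)) (Pi\<^sub>E {..<m} W) \<le> emeasure (PiM {..<m} (\<lambda>_. lborel)) U"
    using W(3) openin_euclid_top_sets[OF U] by (intro emeasure_mono) (simp_all add: sets_PiM_lborel)
  ultimately show ?thesis by auto
qed

text \<open>Integrating out the first spin leaves the density \<open>other_weight\<close> times the
  total weight with respect to Lebesgue measure. It is positive everywhere, so null sets of the law
  are Lebesgue null and cannot be nonempty open sets.\<close>

lemma measure_support_other_law_gibbs:
  assumes V[measurable]: "V \<in> borel_measurable borel" and V0: "\<And>x. 0 \<le> V x" and m: "1 \<le> m"
  shows "measure_support (euclid_top m) (distr (gibbs V (Suc m)) (euclid m) (other_spins (Suc m))) = space (euclid m)"
proof -
  let ?\<rho> = "gibbs V (Suc m)"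
  have "emeasure (distr ?\<rho> (euclid m) (other_spins (Suc m))) U > 0"
    if U: "openin (euclid_top m) U" and y: "y \<in> U" for U y
  proof -
    have U'[measurable]: "U \<in> sets (euclid m)" by (rule openin_euclid_top_sets[OF U])
    then have [measurable]: "U \<in> sets (PiM {..<m} (\<lambda>_. lborel))" by (simp add: sets_PiM_lborel)
    let ?Z = "\<lambda>y. (\<integral>x. gamma_weight V (Suc m) (mag m y) x \<partial>lborel)"
    have "emeasure (distr ?\<rho> (euclid m) (other_spins (Suc m))) U =
        (\<integral>\<^sup>+y. indicator U y \<partial>distr ?\<rho> (euclid m) (other_spins (Suc m)))"
      by simp
    also have "\<dots> = (\<integral>\<^sup>+x. indicator U (other_spins (Suc m) x) \<partial>?\<rho>)"
      by (intro nn_integral_distr) (simp_all cong: measurable_cong_sets)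
    also have "\<dots> = (\<integral>\<^sup>+y. ennreal (other_weight V m y) *
        (\<integral>\<^sup>+t. ennreal (gamma_weight V (Suc m) (mag m y) t) * indicator U (other_spins (Suc m) (cons_spin m y t)) \<partial>lborel) \<partial>PiM {..<m} (\<lambda>_. lborel))"
      by (intro nn_integral_gibbs assms) measurable
    also have "\<dots> = (\<integral>\<^sup>+y. ennreal (other_weight V m y) * (ennreal (?Z y) * indicator U y) \<partial>PiM {..<m} (\<lambda>_. lborel))"
    proof (rule nn_integral_cong, rule arg_cong2[where f = "(*)", OF refl])
      fix y assume "y \<in> space (PiM {..<m} (\<lambda>_. lborel :: real measure))"
      then have "y \<in> extensional {..<m}" by (simp add: space_PiM PiE_iff)
      then have "other_spins (Suc m) (cons_spin m y t) = y" for t by (rule other_spins_cons_spin)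
      then show "(\<integral>\<^sup>+t. ennreal (gamma_weight V (Suc m) (mag m y) t) * indicator U (other_spins (Suc m) (cons_spin m y t)) \<partial>lborel) =
          ennreal (?Z y) * indicator U y"
        by (simp add: nn_integral_multc nn_integral_gamma_weight[OF assms(1,2)])
    qed
    finally have eq: "emeasure (distr ?\<rho> (euclid m) (other_spins (Suc m))) U =
        (\<integral>\<^sup>+y. ennreal (other_weight V m y) * (ennreal (?Z y) * indicator U y) \<partial>PiM {..<m} (\<lambda>_. lborel))" .
    have pos: "ennreal (other_weight V m y) \<noteq> 0" "ennreal (?Z y) \<noteq> 0" for y
      using gibbs_Z_pos[OF V V0] integral_gamma_weight_pos[OF V V0]
      by (simp_all add: other_weight_def ennreal_eq_0_iff not_le)
    have "emeasure (distr ?\<rho> (euclid m) (other_spins (Suc m))) U \<noteq> 0"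
    proof
      assume "emeasure (distr ?\<rho> (euclid m) (other_spins (Suc m))) U = 0"
      then have "AE y in PiM {..<m} (\<lambda>_. lborel). ennreal (other_weight V m y) * (ennreal (?Z y) * indicator U y) = 0"
        unfolding eq by (subst (asm) nn_integral_0_iff_AE) auto
      then have "AE y in PiM {..<m} (\<lambda>_. lborel). y \<notin> U"
        by eventually_elim (auto simp: pos)
      then have "emeasure (PiM {..<m} (\<lambda>_. lborel)) U = 0"
        by (subst (asm) AE_iff_measurable[OF _ refl])
          (use sets.sets_into_space[of U "PiM {..<m} (\<lambda>_. lborel)"] in \<open>auto simp: Int_absorb1 Collect_conj_eq\<close>)
      then show False using emeasure_PiM_lborel_open_pos[OF U y] by simp
    qed
    then show ?thesis by (simp add: zero_less_iff_neq_zero)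
  qed
  then show ?thesis
    by (auto simp: measure_support_def space_PiM)
qed

lemma continuous_map_mag: "continuous_map (euclid_top m) euclideanreal (mag m)"
  unfolding mag_def[abs_def] divide_inverse
  by (intro continuous_map_real_mult continuous_map_sum continuous_map_product_projection) auto

text \<open>No configuration of the other spins lies outside the support, so properness holds
  vacuously. Weak continuity follows by composing \<open>gamma_bar\<close> with the continuous
  magnetisation.\<close>

lemma wcp_cond_prob_gibbs:
  assumes "V \<in> borel_measurable borel" and "\<And>x. 0 \<le> V x" and "2 \<le> n"
  shows "wcp_cond_prob n (gibbs V n) (\<lambda>v. gamma_bar V n (mag (n - 1) v))"
proof -
  from \<open>2 \<le> n\<close> obtain m where n: "n = Suc m" and m: "1 \<le> m"
    by (cases n) auto
  have "proper_kernel n (gibbs V n) (\<lambda>v. gamma_bar V n (mag (n - 1) v))"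
    by (simp add: proper_kernel_def n measure_support_other_law_gibbs[OF assms(1,2) m])
  moreover have "weakly_continuous (euclid_top (n - 1)) (\<lambda>v. gamma_bar V n (mag (n - 1) v))"
    unfolding weakly_continuous_def
  proof
    fix f assume f: "f \<in> bdd_cont"
    have "continuous_map euclideanreal euclideanreal (\<lambda>\<alpha>. integral\<^sup>L (gamma_bar V n \<alpha>) f)"
      using continuous_gamma_bar[OF assms(1,2) _ f] \<open>2 \<le> n\<close> by simp
    from continuous_map_compose[OF continuous_map_mag this]
    show "continuous_map (euclid_top (n - 1)) euclideanreal (\<lambda>y. integral\<^sup>L (gamma_bar V n (mag (n - 1) y)) f)"
      by (simp add: o_def)
  qed
  ultimately show ?thesis
    using regular_cond_prob_gibbs[OF assms(1,2) m] by (simp add: wcp_cond_prob_def n)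
qed

subsection \<open>Limits of the kernels\<close>

text \<open>A mean value theorem for either order of the endpoints, because the increments
  \<open>x / real n\<close> take both signs.\<close>

lemma mvt_closed_segment:
  fixes f f' :: "real \<Rightarrow> real"
  assumes "\<And>x. x \<in> closed_segment a b \<Longrightarrow> (f has_real_derivative f' x) (at x)"
  shows "\<exists>z\<in>closed_segment a b. f b - f a = (b - a) * f' z"
proof -
  consider "a = b" | "a < b" | "b < a" by linarith
  then show ?thesis
  proof cases
    case 2
    then obtain z where "a < z" "z < b" "f b - f a = (b - a) * f' z"
      using MVT2[of a b f f'] assms by (auto simp: closed_segment_eq_real_ivl)
    with 2 show ?thesis by (auto simp: closed_segment_eq_real_ivl)
  next
    case 3
    then obtain z where "b < z" "z < a" "f a - f b = (a - b) * f' z"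
      using MVT2[of b a f f'] assms by (auto simp: closed_segment_eq_real_ivl)
    with 3 show ?thesis
      by (intro bexI[of _ z]) (auto simp: closed_segment_eq_real_ivl algebra_simps)
  qed simp
qed

text \<open>The definition provides only some continuous derivative \<open>D\<close>; by uniqueness
  of derivatives it agrees with \<open>deriv f\<close> on \<open>S\<close>.\<close>

lemma C1_differentiable_on_real_deriv:
  fixes f :: "real \<Rightarrow> real"
  assumes "f C1_differentiable_on S"
  shows "\<And>x. x \<in> S \<Longrightarrow> (f has_real_derivative deriv f x) (at x)" "continuous_on S (deriv f)"
proof -
  obtain D where D: "\<And>x. x \<in> S \<Longrightarrow> (f has_vector_derivative D x) (at x)" "continuous_on S D"
    using assms by (auto simp: C1_differentiable_on_def)
  then have D': "(f has_real_derivative D x) (at x)" if "x \<in> S" for x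
    using that by (simp add: has_real_derivative_iff_has_vector_derivative)
  then have "deriv f x = D x" if "x \<in> S" for x
    using that by (blast intro: DERIV_imp_deriv)
  then show "\<And>x. x \<in> S \<Longrightarrow> (f has_real_derivative deriv f x) (at x)" "continuous_on S (deriv f)"
    using D' D(2) by (simp_all cong: continuous_on_cong)
qed

lemma tendsto_rescaled_centre:
  assumes "a \<longlonglongrightarrow> \<alpha>"
  shows "(\<lambda>n. (real n - 1) / real n * a n) \<longlonglongrightarrow> \<alpha>"
proof -
  have "(\<lambda>n. 1 - 1 / real n) \<longlonglongrightarrow> 1 - 0"
    by (intro tendsto_diff tendsto_const lim_1_over_n)
  then have "(\<lambda>n. (real n - 1) / real n) \<longlonglongrightarrow> 1 - 0"
    by (rule Lim_transform_eventually)
      (auto intro!: eventually_mono[OF eventually_gt_at_top[of 0]] simp: diff_divide_distrib)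
  from tendsto_mult[OF this assms] show ?thesis by simp
qed

text \<open>By the mean value theorem the expression is \<open>x\<close> times the derivative at a
  point between \<open>c n\<close> and \<open>c n + x / real n\<close>; these points tend to
  \<alpha>, where the derivative is continuous.\<close>

lemma tendsto_rescaled_increment:
  fixes V :: "real \<Rightarrow> real"
  assumes U: "open U" "\<alpha> \<in> U" "V C1_differentiable_on U" and c: "c \<longlonglongrightarrow> \<alpha>"
  shows "(\<lambda>n. real n * (V (c n + x / real n) - V (c n))) \<longlonglongrightarrow> deriv V \<alpha> * x"
proof -
  note D = C1_differentiable_on_real_deriv[OF U(3)]
  obtain e where e: "0 < e" "ball \<alpha> e \<subseteq> U" using U openE by blast
  have x0: "(\<lambda>n. x / real n) \<longlonglongrightarrow> 0" by (rule lim_const_over_n)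
  have cx: "(\<lambda>n. c n + x / real n) \<longlonglongrightarrow> \<alpha>" using tendsto_add[OF c x0] by simp
  \<comment> \<open>Stated as an implication so that \<open>z n\<close> can be chosen for every
    \<open>n\<close>, although both endpoints lie in the ball only eventually.\<close>
  have "\<exists>z. c n \<in> ball \<alpha> e \<and> c n + x / real n \<in> ball \<alpha> e \<longrightarrow>
      z \<in> closed_segment (c n) (c n + x / real n) \<and> V (c n + x / real n) - V (c n) = x / real n * deriv V z" for n
  proof (cases "c n \<in> ball \<alpha> e \<and> c n + x / real n \<in> ball \<alpha> e")
    case True
    then have "closed_segment (c n) (c n + x / real n) \<subseteq> U"
      using closed_segment_subset[OF _ _ convex_ball] e(2) by blast
    then show ?thesis
      using mvt_closed_segment[of "c n" "c n + x / real n" V "deriv V"] D(1) by fastforce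
  qed blast
  then obtain z where z: "\<And>n. c n \<in> ball \<alpha> e \<Longrightarrow> c n + x / real n \<in> ball \<alpha> e \<Longrightarrow>
      z n \<in> closed_segment (c n) (c n + x / real n) \<and> V (c n + x / real n) - V (c n) = x / real n * deriv V (z n)"
    by metis
  have ball: "\<forall>\<^sub>F n in sequentially. c n \<in> ball \<alpha> e" "\<forall>\<^sub>F n in sequentially. c n + x / real n \<in> ball \<alpha> e"
    using topological_tendstoD[OF c, of "ball \<alpha> e"] topological_tendstoD[OF cx, of "ball \<alpha> e"] e(1) by simp_all
  have "(\<lambda>n. z n - c n) \<longlonglongrightarrow> 0"
  proof (rule Lim_null_comparison[OF _ tendsto_rabs_zero[OF x0]])
    show "\<forall>\<^sub>F n in sequentially. norm (z n - c n) \<le> \<bar>x / real n\<bar>"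
      using ball
    proof eventually_elim
      case (elim n)
      with z have "z n \<in> closed_segment (c n) (c n + x / real n)" by blast
      moreover have "\<bar>t - u\<bar> \<le> \<bar>h\<bar>" if "t \<in> closed_segment u (u + h)" for t u h :: real
        using that by (auto simp: closed_segment_eq_real_ivl split: if_splits)
      ultimately show ?case by (simp only: real_norm_def)
    qed
  qed
  from tendsto_add[OF this c] have "z \<longlonglongrightarrow> \<alpha>" by simp
  moreover have "isCont (deriv V) \<alpha>"
    using D(2) U by (simp add: continuous_on_eq_continuous_at)
  ultimately have "(\<lambda>n. deriv V (z n) * x) \<longlonglongrightarrow> deriv V \<alpha> * x"
    by (intro tendsto_mult_right) (rule isCont_tendsto_compose)
  then show ?thesis
  proof (rule Lim_transform_eventually)
    show "\<forall>\<^sub>F n in sequentially. deriv V (z n) * x = real n * (V (c n + x / real n) - V (c n))"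
      using ball eventually_gt_at_top[of 0]
    proof eventually_elim
      case (elim n)
      with z have "V (c n + x / real n) - V (c n) = x / real n * deriv V (z n)" by blast
      with elim show ?case by simp
    qed
  qed
qed

text \<open>Close to the centre the increment is controlled by the derivative; where \<open>\<bar>x\<bar> > \<delta> n\<close>, nonnegativity
  of \<open>V\<close> leaves the loss \<open>n V (c n)\<close>, which is again linear in \<open>\<bar>x\<bar>\<close>.\<close>

lemma rescaled_increment_bound:
  fixes V :: "real \<Rightarrow> real"
  assumes V0: "\<And>x. 0 \<le> V x" and U: "open U" "\<alpha> \<in> U" "V C1_differentiable_on U" and c: "c \<longlonglongrightarrow> \<alpha>"
  shows "\<exists>L. \<forall>\<^sub>F n in sequentially. \<forall>x. - (real n * (V (c n + x / real n) - V (c n))) \<le> L * \<bar>x\<bar>"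
proof -
  note D = C1_differentiable_on_real_deriv[OF U(3)]
  obtain e where e: "0 < e" "cball \<alpha> e \<subseteq> U" using U open_contains_cball by blast
  \<comment> \<open>Half the radius: if \<open>c n\<close> is within \<delta> of the centre and the
    increment is at most \<delta>, the whole segment stays in
    \<open>cball \<alpha> e\<close>.\<close>
  define \<delta> where "\<delta> = e / 2"
  have \<delta>: "0 < \<delta>" using e by (simp add: \<delta>_def)
  have "continuous_on (cball \<alpha> e) (deriv V)" by (rule continuous_on_subset[OF D(2) e(2)])
  then have "compact (deriv V ` cball \<alpha> e)" by (rule compact_continuous_image) simp
  from compact_imp_bounded[OF this] obtain K where K: "\<And>x. x \<in> cball \<alpha> e \<Longrightarrow> \<bar>deriv V x\<bar> \<le> K"
    unfolding bounded_iff by (metis imageI real_norm_def)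
  then have K0: "0 \<le> K" using e(1) by (meson abs_ge_zero centre_in_cball less_imp_le order_trans)
  have "continuous_on (cball \<alpha> e) V"
    using D(1) e(2) by (intro continuous_at_imp_continuous_on ballI) (blast intro: DERIV_isCont)
  then have "compact (V ` cball \<alpha> e)" by (rule compact_continuous_image) simp
  from compact_imp_bounded[OF this] obtain C where C: "\<And>x. x \<in> cball \<alpha> e \<Longrightarrow> \<bar>V x\<bar> \<le> C"
    unfolding bounded_iff by (metis imageI real_norm_def)
  then have C0: "0 \<le> C" using e(1) by (meson abs_ge_zero centre_in_cball less_imp_le order_trans)
  have "\<forall>\<^sub>F n in sequentially. c n \<in> ball \<alpha> \<delta>"
    using topological_tendstoD[OF c, of "ball \<alpha> \<delta>"] \<delta> by simp
  \<comment> \<open>The slope \<open>K\<close> handles small increments and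
    \<open>C / \<delta>\<close> large ones; their sum serves both cases.\<close>
  then have "\<forall>\<^sub>F n in sequentially. \<forall>x. - (real n * (V (c n + x / real n) - V (c n))) \<le> (K + C / \<delta>) * \<bar>x\<bar>"
    using eventually_gt_at_top[of 0]
  proof eventually_elim
    case (elim n)
    show ?case
    proof
      fix x
      have cn: "c n \<in> cball \<alpha> e" using elim(1) e(1) by (simp add: \<delta>_def)
      show "- (real n * (V (c n + x / real n) - V (c n))) \<le> (K + C / \<delta>) * \<bar>x\<bar>"
      proof (cases "\<bar>x / real n\<bar> \<le> \<delta>")
        case True
        then have "c n + x / real n \<in> cball \<alpha> e"
          using elim(1) unfolding mem_ball mem_cball dist_real_def \<delta>_def by linarith
        with cn have seg: "closed_segment (c n) (c n + x / real n) \<subseteq> cball \<alpha> e"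
          by (simp add: closed_segment_subset)
        then obtain z where z: "z \<in> cball \<alpha> e" "V (c n + x / real n) - V (c n) = x / real n * deriv V z"
          using mvt_closed_segment[of "c n" "c n + x / real n" V "deriv V"] D(1) e(2) by fastforce
        have "- (real n * (V (c n + x / real n) - V (c n))) = - (x * deriv V z)"
          using elim(2) by (simp add: z(2))
        also have "\<dots> \<le> \<bar>x * deriv V z\<bar>" by simp
        also have "\<dots> \<le> K * \<bar>x\<bar>"
          using mult_right_mono[OF K[OF z(1)], of "\<bar>x\<bar>"] by (simp add: abs_mult mult.commute)
        also have "\<dots> \<le> (K + C / \<delta>) * \<bar>x\<bar>"
          using C0 \<delta> by (intro mult_right_mono) auto
        finally show ?thesis .
      next
        case False
        then have "real n \<le> \<bar>x\<bar> / \<delta>"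
          using elim(2) \<delta> by (simp add: field_simps)
        moreover have "V (c n) - V (c n + x / real n) \<le> C"
          using C[OF cn] V0[of "c n + x / real n"] by linarith
        ultimately have "real n * (V (c n) - V (c n + x / real n)) \<le> \<bar>x\<bar> / \<delta> * C"
          using C0 \<delta> by (meson mult_left_mono mult_right_mono of_nat_0_le_iff order_trans)
        also have "\<dots> \<le> (K + C / \<delta>) * \<bar>x\<bar>"
          using K0 by (simp add: distrib_right distrib_left mult.commute)
        finally show ?thesis by (simp add: algebra_simps)
      qed
    qed
  qed
  then show ?thesis by blast
qed

section \<open>Convergence of the kernels and good magnetisations\<close>

text \<open>The factor \<open>exp (- (real n * V (c n)))\<close> cancels in the quotient. Test
  functions are merely bounded and measurable, so that continuous functions give weak convergence
  and indicators give strong convergence.\<close>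

lemma tendsto_integral_gamma_bar:
  fixes V f :: "real \<Rightarrow> real"
  assumes V[measurable]: "V \<in> borel_measurable borel" and V0: "\<And>x. 0 \<le> V x"
    and U: "open U" "\<alpha> \<in> U" "V C1_differentiable_on U" and a: "a \<longlonglongrightarrow> \<alpha>"
    and f[measurable]: "f \<in> borel_measurable borel" and f_bdd: "bounded (range f)"
  shows "(\<lambda>n. integral\<^sup>L (gamma_bar V n (a n)) f) \<longlonglongrightarrow>
    integral\<^sup>L (density lborel (normal_density (- deriv V \<alpha>) 1)) f"
proof -
  let ?d = "- deriv V \<alpha>"
  define c where "c n = (real n - 1) / real n * a n" for n
  define u where "u n x = exp (- (real n * (V (c n + x / real n) - V (c n)))) * exp (- x\<^sup>2 / 2)" for n x
  have [measurable]: "u n \<in> borel_measurable borel" for n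
    unfolding u_def[abs_def] by measurable
  have c: "c \<longlonglongrightarrow> \<alpha>" unfolding c_def[abs_def] by (rule tendsto_rescaled_centre[OF a])
  have w: "gamma_weight V n (a n) x = exp (- (real n * V (c n))) * u n x" for n x
    by (simp add: gamma_weight_def u_def c_def exp_add[symmetric] right_diff_distrib)
  obtain L where L: "\<forall>\<^sub>F n in sequentially. \<forall>x. - (real n * (V (c n + x / real n) - V (c n))) \<le> L * \<bar>x\<bar>"
    using rescaled_increment_bound[OF V0 U c] by blast
  then obtain N where N: "\<And>n x. N \<le> n \<Longrightarrow> - (real n * (V (c n + x / real n) - V (c n))) \<le> L * \<bar>x\<bar>"
    by (auto simp: eventually_sequentially)
  have conv: "(\<lambda>n. \<integral>x. u n x * g x \<partial>lborel) \<longlonglongrightarrow> (\<integral>x. exp (?d * x - x\<^sup>2 / 2) * g x \<partial>lborel)"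
    if [measurable]: "g \<in> borel_measurable borel" and B: "\<And>x. \<bar>g x\<bar> \<le> B" for g B
  \<comment> \<open>The majorant is valid only from \<open>N\<close> on, whereas dominated
    convergence asks for it at every index; hence the shift.\<close>
  proof (rule LIMSEQ_offset[of _ N], rule integral_dominated_convergence)
    show "integrable lborel (\<lambda>x. B * exp (L * \<bar>x\<bar> - x\<^sup>2 / 2))"
      by (intro Bochner_Integration.integrable_mult_right integrable_exp_abs_minus_square)
    show "AE x in lborel. (\<lambda>n. u (n + N) x * g x) \<longlonglongrightarrow> exp (?d * x - x\<^sup>2 / 2) * g x"
    proof (rule AE_I2)
      fix x
      have "(\<lambda>n. u n x * g x) \<longlonglongrightarrow> exp (- (deriv V \<alpha> * x)) * exp (- x\<^sup>2 / 2) * g x"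
        unfolding u_def by (intro tendsto_intros tendsto_rescaled_increment[OF U c])
      then have "(\<lambda>n. u n x * g x) \<longlonglongrightarrow> exp (?d * x - x\<^sup>2 / 2) * g x"
        by (simp add: exp_add[symmetric])
      then show "(\<lambda>n. u (n + N) x * g x) \<longlonglongrightarrow> exp (?d * x - x\<^sup>2 / 2) * g x"
        by (rule LIMSEQ_ignore_initial_segment)
    qed
    show "AE x in lborel. norm (u (n + N) x * g x) \<le> B * exp (L * \<bar>x\<bar> - x\<^sup>2 / 2)" for n
    proof (rule AE_I2)
      fix x
      have u: "0 \<le> u (n + N) x" "u (n + N) x \<le> exp (L * \<bar>x\<bar> - x\<^sup>2 / 2)"
        using N[of "n + N" x] unfolding u_def exp_add[symmetric] by simp_all
      then have "u (n + N) x * \<bar>g x\<bar> \<le> exp (L * \<bar>x\<bar> - x\<^sup>2 / 2) * B"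
        using B by (intro mult_mono) auto
      then show "norm (u (n + N) x * g x) \<le> B * exp (L * \<bar>x\<bar> - x\<^sup>2 / 2)"
        using u(1) by (simp add: abs_mult mult.commute)
    qed
  qed measurable
  let ?k = "sqrt (2 * pi) * exp (?d\<^sup>2 / 2)" and ?N = "density lborel (normal_density ?d 1)"
  have k: "0 < ?k" by simp
  have lim: "(\<integral>x. exp (?d * x - x\<^sup>2 / 2) * g x \<partial>lborel) = ?k * integral\<^sup>L ?N g"
    if [measurable]: "g \<in> borel_measurable borel" for g :: "real \<Rightarrow> real"
    unfolding exp_linear_minus_square by (simp add: integral_density mult.assoc)
  obtain B where B: "\<And>x. \<bar>f x\<bar> \<le> B" using f_bdd by (auto simp: bounded_iff)
  interpret N: prob_space ?N by (rule prob_space_normal_density) simp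
  \<comment> \<open>Numerator and denominator carry the same factor from completing the square,
    which cancels and leaves the integral against the normal law.\<close>
  have "(\<lambda>n. (\<integral>x. u n x * f x \<partial>lborel) / (\<integral>x. u n x * 1 \<partial>lborel)) \<longlonglongrightarrow>
      (?k * integral\<^sup>L ?N f) / (?k * integral\<^sup>L ?N (\<lambda>_. 1))"
    using conv[OF f B] conv[of "\<lambda>_. 1" 1] k
    by (intro tendsto_divide) (simp_all only: lim f, simp_all add: N.prob_space[simplified])
  then have "(\<lambda>n. (\<integral>x. u n x * f x \<partial>lborel) / (\<integral>x. u n x \<partial>lborel)) \<longlonglongrightarrow> integral\<^sup>L ?N f"
    using k by (simp add: N.prob_space[simplified])
  moreover have "integral\<^sup>L (gamma_bar V n (a n)) f = (\<integral>x. u n x * f x \<partial>lborel) / (\<integral>x. u n x \<partial>lborel)" for n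
    by (simp add: integral_gamma_bar w mult.assoc)
  ultimately show ?thesis by simp
qed

lemma good_magnetisation_gibbs:
  fixes V :: "real \<Rightarrow> real"
  assumes V: "V \<in> borel_measurable borel" and V0: "\<And>x. 0 \<le> V x"
    and U: "open U" "\<alpha> \<in> U" "V C1_differentiable_on U"
  shows "good_magnetisation (gibbs V) \<alpha>"
  unfolding good_magnetisation_def
proof (intro exI conjI allI impI)
  let ?N = "density lborel (normal_density (- deriv V \<alpha>) 1)"
  show "wcp_cond_prob n (gibbs V n) ((\<lambda>n v. gamma_bar V n (mag (n - 1) v)) n)" if "2 \<le> n" for n
    using wcp_cond_prob_gibbs[OF V V0 that] .
  show "real_distribution ?N"
    by (simp add: real_distribution_def real_distribution_axioms_def prob_space_normal_density)
  fix v assume v: "(\<forall>n\<ge>1. v n \<in> space (euclid n)) \<and> (\<lambda>n. mag n (v n)) \<longlonglongrightarrow> \<alpha>"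
  \<comment> \<open>Reindexing: the kernel for \<open>n\<close> spins receives the magnetisation of
    the other \<open>n - 1\<close>. The truncated value at \<open>0\<close> does not affect the
    limit.\<close>
  define a where "a n = mag (n - 1) (v (n - 1))" for n
  have "(\<lambda>n. a (Suc n)) \<longlonglongrightarrow> \<alpha>" using v by (simp add: a_def)
  then have a: "a \<longlonglongrightarrow> \<alpha>" by (rule LIMSEQ_imp_Suc)
  show "weakly_converges (\<lambda>n. gamma_bar V (Suc n) (mag (Suc n - 1) (v n))) ?N"
    unfolding weakly_converges_def
  proof
    fix f assume "f \<in> bdd_cont"
    then have "(\<lambda>n. integral\<^sup>L (gamma_bar V n (a n)) f) \<longlonglongrightarrow> integral\<^sup>L ?N f"
      by (intro tendsto_integral_gamma_bar[OF V V0 U a])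
        (auto simp: bdd_cont_def intro: borel_measurable_continuous_onI)
    from LIMSEQ_Suc[OF this]
    show "(\<lambda>n. integral\<^sup>L (gamma_bar V (Suc n) (mag (Suc n - 1) (v n))) f) \<longlonglongrightarrow> integral\<^sup>L ?N f"
      by (simp add: a_def)
  qed
qed

theorem theorem1:
  fixes V :: "real \<Rightarrow> real"
  assumes "V \<in> borel_measurable borel"
    and "\<And>x. 0 \<le> V x"
  shows "(\<forall>n\<ge>2.
            wcp_cond_prob n (gibbs V n) (\<lambda>v. gamma_bar V n (mag (n - 1) v)) \<and>
            (\<forall>\<gamma>. wcp_cond_prob n (gibbs V n) \<gamma> \<longrightarrow>
              (\<forall>v\<in>space (euclid (n - 1)). \<gamma> v = gamma_bar V n (mag (n - 1) v)))) \<and>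
         (\<forall>\<alpha>. (\<exists>U. open U \<and> \<alpha> \<in> U \<and> V C1_differentiable_on U) \<longrightarrow>
            (\<forall>a. a \<longlonglongrightarrow> \<alpha> \<longrightarrow>
              weakly_converges (\<lambda>n. gamma_bar V n (a n))
                (density lborel (normal_density (- deriv V \<alpha>) 1)) \<and>
              (\<forall>A\<in>sets borel. (\<lambda>n. measure (gamma_bar V n (a n)) A)
                \<longlonglongrightarrow> measure (density lborel (normal_density (- deriv V \<alpha>) 1)) A)) \<and>
            good_magnetisation (gibbs V) \<alpha>) \<and>
         (V C1_differentiable_on UNIV \<longrightarrow> sequentially_gibbs (gibbs V))"
proof (intro conjI allI impI ballI; (elim exE conjE)?)
  fix n :: nat assume n: "2 \<le> n"
  show "wcp_cond_prob n (gibbs V n) (\<lambda>v. gamma_bar V n (mag (n - 1) v))"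
    by (rule wcp_cond_prob_gibbs) fact+
  then show "\<gamma> v = gamma_bar V n (mag (n - 1) v)"
    if "wcp_cond_prob n (gibbs V n) \<gamma>" "v \<in> space (euclid (n - 1))" for \<gamma> v
    using wcp_cond_prob_unique that by blast
next
  fix \<alpha> U assume U: "open U" "\<alpha> \<in> U" "V C1_differentiable_on U"
  show "good_magnetisation (gibbs V) \<alpha>"
    by (rule good_magnetisation_gibbs) fact+
  fix a assume a: "a \<longlonglongrightarrow> \<alpha>"
  note conv = tendsto_integral_gamma_bar[OF assms U a]
  show "weakly_converges (\<lambda>n. gamma_bar V n (a n)) (density lborel (normal_density (- deriv V \<alpha>) 1))"
    unfolding weakly_converges_def
    by (auto simp: bdd_cont_def intro!: conv borel_measurable_continuous_onI)
  fix A :: "real set" assume "A \<in> sets borel"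
  moreover have "bounded (range (indicator A :: real \<Rightarrow> real))"
    by (auto simp: bounded_iff indicator_def intro!: exI[of _ 1])
  \<comment> \<open>Strong convergence is the case of an indicator as test function.\<close>
  ultimately show "(\<lambda>n. measure (gamma_bar V n (a n)) A)
      \<longlonglongrightarrow> measure (density lborel (normal_density (- deriv V \<alpha>) 1)) A"
    using conv[of "indicator A"] by simp
next
  assume "V C1_differentiable_on UNIV"
  then show "sequentially_gibbs (gibbs V)"
    unfolding sequentially_gibbs_def
    using good_magnetisation_gibbs[OF assms open_UNIV UNIV_I] by blast
qed

end
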